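(* Let $q\in\mathbb{C}$, $q\neq 0,1$, let $F(z,y_0,\ldots,y_n)$ be a polynomial, and let the generalized formal power series $$\varphi=\sum_{j=0}^{\infty}c_jz^{\lambda_j}=\sum_{j=0}^{j_0}c_jz^{\lambda_j}+\sum_{(m_1,\ldots,m_s)\in\mathbb{Z}_+^s\setminus\{0\}}c_{m_1,\ldots,m_s}z^{\lambda_{j_0}+m_1\alpha_1+\ldots+m_s\alpha_s}$$ be a formal solution of the $q$-difference equation $F(z,y,\sigma y,\ldots,\sigma^n y)=0$, with $j_0$, $\alpha_1,\ldots,\alpha_s$ and the associated polynomial $L(\xi)=A_n\xi^n+\ldots+A_1\xi+A_0$ as described in the context. Suppose that $\deg L=n$, $L(0)\neq 0$, and that there are positive constants $c,\nu$ such that for each root $\xi=a$ of the polynomial $(\xi-q^{\lambda_{j_0}})L(\xi)$ one has $$\bigl|(\lambda_{j_0}+m_1\alpha_1+\ldots+m_s\alpha_s)\ln q-\ln a-2\pi m\mathrm{i}\bigr|>c\,|m_1+\ldots+m_s|^{-\nu}$$ for all $(m_1,\ldots,m_s)\in\mathbb{Z}_+^s\setminus\{0\}$ and all $m\in\mathbb{Z}$. Then $\varphi$ has a non-zero radius of convergence, that is, it converges uniformly in any sector $S\subset\mathbb{C}$ of sufficiently small radius with the vertex at the origin and of opening less than $2\pi$, defining there a germ of a holomorphic function.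
   Context: $\mathbb{Z}_+=\{0,1,2,\ldots\}$. The value $\ln q$ is fixed by $0\leqslant\arg q<2\pi$, and $q^{\mu}=e^{\mu\ln q}$ for $\mu\in\mathbb{C}$; $\ln a$ is any fixed value of the logarithm. On a sector, $z^{\mu}=e^{\mu\ln z}$ with a fixed branch of $\ln z$. A generalized formal power series is $\varphi=\sum_{j\geqslant0}c_jz^{\lambda_j}$ with $c_j,\lambda_j\in\mathbb{C}$, $c_0\ne0$, where (i) $\mathrm{Re}\,\lambda_j\leqslant\mathrm{Re}\,\lambda_{j+1}$ for all $j$, and (ii) $\mathrm{Re}\,\lambda_j\to+\infty$. Such series (together with $0$) form an algebra over $\mathbb{C}$, on which the dilatation operator $\sigma$ ($y(z)\mapsto y(qz)$) acts by $\sigma(\sum c_jz^{\lambda_j})=\sum c_jq^{\lambda_j}z^{\lambda_j}$. The series $\varphi$ is a formal solution of $F(z,y,\sigma y,\ldots,\sigma^ny)=0$ if substituting $y=\varphi$ in $F$ gives the generalized power series with zero coefficients. Standing assumptions. For each $k=0,\ldots,n$, $$\frac{\partial F}{\partial y_k}(z,\varphi,\sigma\varphi,\ldots,\sigma^n\varphi)=A_kz^{\alpha}+B_kz^{\alpha_k'}+\ldots,\qquad \mathrm{Re}\,\alpha_k'>\mathrm{Re}\,\alpha\geqslant0,$$ with $\alpha\in\mathbb{C}$ the same for all $k$ and at least one $A_k$ non-zero; put $L(\xi)=A_n\xi^n+\ldots+A_1\xi+A_0$. The numbers $q^{\lambda_j}$, $j>j_0$, are not roots of $L$. In this situation it is known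 from earlier work that $j_0$ and finitely many $\alpha_1,\ldots,\alpha_s\in\mathbb{C}$ with $\mathrm{Re}\,\alpha_i>0$ can be chosen so that, with $\Gamma=\{m_1\alpha_1+\ldots+m_s\alpha_s:(m_1,\ldots,m_s)\in\mathbb{Z}_+^s\setminus\{0\}\}$, all $\lambda_j-\lambda_{j_0}$, $j>j_0$, belong to $\Gamma$ (so that $\varphi$ has the form displayed in the claim), and the series $\psi=\sum_{(m_1,\ldots,m_s)\ne0}c_{m_1,\ldots,m_s}z^{m_1\alpha_1+\ldots+m_s\alpha_s}$ satisfies an equality $L(q^{\lambda_{j_0}}\sigma)\psi=M(z,\psi,\sigma\psi,\ldots,\sigma^n\psi)$, where $M(z,u_0,\ldots,u_n)$ is a finite linear combination of monomials $z^{\beta}u_0^{p_0}\cdots u_n^{p_n}$ with $\beta\in\Gamma$, $p_i\in\mathbb{Z}_+$. Throughout, $j_0,\alpha_1,\ldots,\alpha_s$ denote such a choice. *)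

theory Defs
  imports "HOL-Analysis.Analysis" "HOL-Library.Poly_Mapping"
    "HOL-Computational_Algebra.Polynomial"
begin

section \<open>The algebra of generalized formal power series\<close>

text \<open>
  An element of the algebra is given by its coefficient function
  \<open>\<mu> \<mapsto> [z\<^sup>\<mu>]\<close>. A sequence of exponents with \<open>Re \<lambda>\<^sub>j\<close> nondecreasing and tending to
  infinity has only finitely many members in each left half-plane; conversely, a support with this
  property can be listed as such a sequence.
\<close>

typedef gps = "{f :: complex \<Rightarrow> complex. \<forall>R. finite {\<mu>. f \<mu> \<noteq> 0 \<and> Re \<mu> \<le> R}}"
  morphisms gps_coeff Abs_gps
  by (rule exI[of _ "\<lambda>_. 0"]) simp

setup_lifting type_definition_gps

lemma gps_eqI: "(\<And>\<mu>. gps_coeff f \<mu> = gps_coeff g \<mu>) \<Longrightarrow> f = g"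
  using gps_coeff_inject[of f g] by (auto simp: fun_eq_iff)

lemma gps_coeff_finite: "finite {\<mu>. gps_coeff f \<mu> \<noteq> 0 \<and> Re \<mu> \<le> R}"
  using gps_coeff[of f] by auto

lemma gps_support_bound:
  fixes f :: "complex \<Rightarrow> complex"
  assumes "\<And>R. finite {\<mu>. f \<mu> \<noteq> 0 \<and> Re \<mu> \<le> R}"
  shows "\<exists>m. \<forall>\<mu>. f \<mu> \<noteq> 0 \<longrightarrow> m \<le> Re \<mu>"
proof -
  let ?A = "{\<mu>. f \<mu> \<noteq> 0 \<and> Re \<mu> \<le> 0}"
  have fin: "finite (insert 0 (Re ` ?A))" using assms[of 0] by simp
  have "Min (insert 0 (Re ` ?A)) \<le> Re \<mu>" if "f \<mu> \<noteq> 0" for \<mu>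
  proof (cases "Re \<mu> \<le> 0")
    case True
    then show ?thesis using fin that by (intro Min_le) auto
  next
    case False
    have "Min (insert 0 (Re ` ?A)) \<le> 0" using fin by (intro Min_le) auto
    then show ?thesis using False by linarith
  qed
  then show ?thesis by blast
qed

definition conv_coeff :: "(complex \<Rightarrow> complex) \<Rightarrow> (complex \<Rightarrow> complex) \<Rightarrow> complex \<Rightarrow> complex" where
  "conv_coeff f g \<mu> = (\<Sum>a | f a \<noteq> 0 \<and> g (\<mu> - a) \<noteq> 0. f a * g (\<mu> - a))"

lemma conv_coeff_nonzeroE:
  assumes "conv_coeff f g \<mu> \<noteq> 0"
  obtains a where "f a \<noteq> 0" "g (\<mu> - a) \<noteq> 0"
proof -
  have "{a. f a \<noteq> 0 \<and> g (\<mu> - a) \<noteq> 0} \<noteq> {}"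
    using assms by (metis conv_coeff_def sum.empty)
  then show thesis using that by blast
qed

lemma conv_coeff_superset:
  assumes "finite A" "\<And>a. f a \<noteq> 0 \<Longrightarrow> g (\<mu> - a) \<noteq> 0 \<Longrightarrow> a \<in> A"
  shows "conv_coeff f g \<mu> = (\<Sum>a\<in>A. f a * g (\<mu> - a))"
  unfolding conv_coeff_def
  by (rule sum.mono_neutral_left) (use assms in auto)

lemma conv_coeff_finite:
  fixes f g :: "complex \<Rightarrow> complex"
  assumes f: "\<And>R. finite {\<mu>. f \<mu> \<noteq> 0 \<and> Re \<mu> \<le> R}"
    and g: "\<And>R. finite {\<mu>. g \<mu> \<noteq> 0 \<and> Re \<mu> \<le> R}"
  shows "finite {\<mu>. conv_coeff f g \<mu> \<noteq> 0 \<and> Re \<mu> \<le> R}"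
proof -
  obtain mf where mf: "\<And>\<mu>. f \<mu> \<noteq> 0 \<Longrightarrow> mf \<le> Re \<mu>" using gps_support_bound[OF f] by auto
  obtain mg where mg: "\<And>\<mu>. g \<mu> \<noteq> 0 \<Longrightarrow> mg \<le> Re \<mu>" using gps_support_bound[OF g] by auto
  have "{\<mu>. conv_coeff f g \<mu> \<noteq> 0 \<and> Re \<mu> \<le> R} \<subseteq>
      (\<lambda>(a, b). a + b) ` ({\<mu>. f \<mu> \<noteq> 0 \<and> Re \<mu> \<le> R - mg} \<times> {\<mu>. g \<mu> \<noteq> 0 \<and> Re \<mu> \<le> R - mf})"
  proof
    fix \<mu> assume *: "\<mu> \<in> {\<mu>. conv_coeff f g \<mu> \<noteq> 0 \<and> Re \<mu> \<le> R}"
    then obtain a where a: "f a \<noteq> 0" "g (\<mu> - a) \<noteq> 0" by (auto elim: conv_coeff_nonzeroE)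
    have "Re a \<le> R - mg" "Re (\<mu> - a) \<le> R - mf"
      using mf[OF a(1)] mg[OF a(2)] * by auto
    then show "\<mu> \<in> (\<lambda>(a, b). a + b) `
        ({\<mu>. f \<mu> \<noteq> 0 \<and> Re \<mu> \<le> R - mg} \<times> {\<mu>. g \<mu> \<noteq> 0 \<and> Re \<mu> \<le> R - mf})"
      using a by (intro image_eqI[of _ _ "(a, \<mu> - a)"]) auto
  qed
  then show ?thesis
    by (rule finite_subset) (intro finite_imageI finite_cartesian_product f g)
qed

lemma conv_coeff_commute: "conv_coeff f g \<mu> = conv_coeff g f \<mu>"
  unfolding conv_coeff_def
  by (rule sum.reindex_bij_witness[of _ "\<lambda>a. \<mu> - a" "\<lambda>a. \<mu> - a"]) auto

lemma conv_coeff_assoc: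
  fixes f g h :: "complex \<Rightarrow> complex"
  assumes f: "\<And>R. finite {\<mu>. f \<mu> \<noteq> 0 \<and> Re \<mu> \<le> R}"
    and g: "\<And>R. finite {\<mu>. g \<mu> \<noteq> 0 \<and> Re \<mu> \<le> R}"
    and h: "\<And>R. finite {\<mu>. h \<mu> \<noteq> 0 \<and> Re \<mu> \<le> R}"
  shows "conv_coeff (conv_coeff f g) h \<mu> = conv_coeff f (conv_coeff g h) \<mu>"
proof -
  obtain mf where mf: "\<And>\<mu>. f \<mu> \<noteq> 0 \<Longrightarrow> mf \<le> Re \<mu>" using gps_support_bound[OF f] by auto
  obtain mg where mg: "\<And>\<mu>. g \<mu> \<noteq> 0 \<Longrightarrow> mg \<le> Re \<mu>" using gps_support_bound[OF g] by auto
  obtain mh where mh: "\<And>\<mu>. h \<mu> \<noteq> 0 \<Longrightarrow> mh \<le> Re \<mu>" using gps_support_bound[OF h] by auto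
  define A where "A = {a. f a \<noteq> 0 \<and> Re a \<le> Re \<mu> - mg - mh}"
  define D where "D = {a. g a \<noteq> 0 \<and> Re a \<le> Re \<mu> - mf - mh}"
  define B where "B = (\<lambda>(a, d). a + d) ` (A \<times> D)"
  have finA: "finite A" and finD: "finite D" unfolding A_def D_def by (rule f g)+
  have finB: "finite B" unfolding B_def using finA finD by simp
  have AD: "a \<in> A \<and> b - a \<in> D \<and> b \<in> B"
    if "f a \<noteq> 0" "g (b - a) \<noteq> 0" "h (\<mu> - b) \<noteq> 0" for a b
  proof -
    have "mf \<le> Re a" "mg \<le> Re (b - a)" "mh \<le> Re (\<mu> - b)" using that mf mg mh by blast+
    then have "a \<in> A" "b - a \<in> D" using that by (auto simp: A_def D_def)
    then show ?thesis
      unfolding B_def by (auto intro!: image_eqI[of _ _ "(a, b - a)"])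
  qed
  have "conv_coeff (conv_coeff f g) h \<mu> = (\<Sum>b\<in>B. conv_coeff f g b * h (\<mu> - b))"
  proof (rule conv_coeff_superset[OF finB])
    fix b assume "conv_coeff f g b \<noteq> 0" "h (\<mu> - b) \<noteq> 0"
    then show "b \<in> B" using AD by (metis conv_coeff_nonzeroE)
  qed
  also have "\<dots> = (\<Sum>b\<in>B. (\<Sum>a\<in>A. f a * g (b - a) * h (\<mu> - b)))"
  proof (rule sum.cong[OF refl])
    fix b assume "b \<in> B"
    show "conv_coeff f g b * h (\<mu> - b) = (\<Sum>a\<in>A. f a * g (b - a) * h (\<mu> - b))"
    proof (cases "h (\<mu> - b) = 0")
      case False
      then have "conv_coeff f g b = (\<Sum>a\<in>A. f a * g (b - a))"
        using AD by (intro conv_coeff_superset[OF finA]) blast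
      then show ?thesis by (simp add: sum_distrib_right)
    qed simp
  qed
  also have "\<dots> = (\<Sum>a\<in>A. (\<Sum>b\<in>B. f a * g (b - a) * h (\<mu> - b)))"
    by (rule sum.swap)
  also have "\<dots> = (\<Sum>a\<in>A. f a * conv_coeff g h (\<mu> - a))"
  proof (rule sum.cong[OF refl])
    fix a assume a: "a \<in> A"
    have "conv_coeff g h (\<mu> - a) = (\<Sum>d\<in>(\<lambda>b. b - a) ` B. g d * h (\<mu> - a - d))"
    proof (rule conv_coeff_superset)
      fix d assume "g d \<noteq> 0" "h (\<mu> - a - d) \<noteq> 0"
      then have "a + d \<in> B"
        using AD[of a "a + d"] a by (auto simp: A_def diff_diff_eq)
      then show "d \<in> (\<lambda>b. b - a) ` B" by (intro image_eqI[of _ _ "a + d"]) auto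
    qed (use finB in simp)
    also have "\<dots> = (\<Sum>b\<in>B. g (b - a) * h (\<mu> - b))"
      by (subst sum.reindex) (auto simp: inj_on_def)
    finally show "(\<Sum>b\<in>B. f a * g (b - a) * h (\<mu> - b)) = f a * conv_coeff g h (\<mu> - a)"
      by (simp add: sum_distrib_left mult.assoc)
  qed
  also have "\<dots> = conv_coeff f (conv_coeff g h) \<mu>"
  proof (rule conv_coeff_superset[OF finA, symmetric])
    fix a assume a: "f a \<noteq> 0" "conv_coeff g h (\<mu> - a) \<noteq> 0"
    then obtain d where "g d \<noteq> 0" "h (\<mu> - a - d) \<noteq> 0" by (auto elim: conv_coeff_nonzeroE)
    then show "a \<in> A" using AD[of a "a + d"] a by (auto simp: diff_diff_eq)
  qed
  finally show ?thesis .
qed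

lift_definition gps_monom :: "complex \<Rightarrow> complex \<Rightarrow> gps" is
  "\<lambda>c \<beta> \<mu>. if \<mu> = \<beta> then c else 0"
  by (rule finite_subset[of _ "{\<beta>}" for \<beta>]) (auto split: if_splits)

instantiation gps :: comm_ring_1
begin

lift_definition zero_gps :: gps is "\<lambda>_. 0" by simp

definition one_gps :: gps where "1 = gps_monom 1 0"

lift_definition plus_gps :: "gps \<Rightarrow> gps \<Rightarrow> gps" is "\<lambda>f g \<mu>. f \<mu> + g \<mu>"
proof -
  fix f g :: "complex \<Rightarrow> complex" and R
  assume "\<And>R. finite {\<mu>. f \<mu> \<noteq> 0 \<and> Re \<mu> \<le> R}" "\<And>R. finite {\<mu>. g \<mu> \<noteq> 0 \<and> Re \<mu> \<le> R}"
  then have "finite ({\<mu>. f \<mu> \<noteq> 0 \<and> Re \<mu> \<le> R} \<union> {\<mu>. g \<mu> \<noteq> 0 \<and> Re \<mu> \<le> R})" by simp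
  then show "finite {\<mu>. f \<mu> + g \<mu> \<noteq> 0 \<and> Re \<mu> \<le> R}"
    by (rule rev_finite_subset) auto
qed

lift_definition uminus_gps :: "gps \<Rightarrow> gps" is "\<lambda>f \<mu>. - f \<mu>" by simp

definition minus_gps :: "gps \<Rightarrow> gps \<Rightarrow> gps" where "f - g = f + - (g :: gps)"

lift_definition times_gps :: "gps \<Rightarrow> gps \<Rightarrow> gps" is conv_coeff
  by (rule conv_coeff_finite)

instance
proof
  fix f g h :: gps
  show "f + g + h = f + (g + h)" by transfer (simp add: add.assoc)
  show "f + g = g + f" by transfer (simp add: add.commute)
  show "0 + f = f" by transfer simp
  show "- f + f = 0" by transfer simp
  show "f - g = f + - g" by (rule minus_gps_def)
  show "f * g * h = f * (g * h)" by transfer (rule ext, rule conv_coeff_assoc, auto)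
  show "f * g = g * f" by transfer (rule ext, rule conv_coeff_commute)
  show "1 * f = f"
  proof (rule gps_eqI)
    fix \<mu>
    have "gps_coeff (1 * f) \<mu> = (\<Sum>a\<in>{0}. gps_coeff 1 a * gps_coeff f (\<mu> - a))"
      unfolding times_gps.rep_eq
      by (rule conv_coeff_superset) (auto simp: one_gps_def gps_monom.rep_eq split: if_splits)
    then show "gps_coeff (1 * f) \<mu> = gps_coeff f \<mu>"
      by (simp add: one_gps_def gps_monom.rep_eq)
  qed
  show "(f + g) * h = f * h + g * h"
  proof (rule gps_eqI)
    fix \<mu>
    obtain m where m: "\<And>\<nu>. gps_coeff h \<nu> \<noteq> 0 \<Longrightarrow> m \<le> Re \<nu>"
      using gps_support_bound[OF gps_coeff_finite[of h]] by auto
    let ?A = "{a. gps_coeff f a \<noteq> 0 \<and> Re a \<le> Re \<mu> - m} \<union>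
              {a. gps_coeff g a \<noteq> 0 \<and> Re a \<le> Re \<mu> - m}"
    have fin: "finite ?A" using gps_coeff_finite by simp
    have *: "conv_coeff k (gps_coeff h) \<mu> = (\<Sum>a\<in>?A. k a * gps_coeff h (\<mu> - a))"
      if "\<And>a. k a \<noteq> 0 \<Longrightarrow> gps_coeff f a \<noteq> 0 \<or> gps_coeff g a \<noteq> 0" for k
    proof (rule conv_coeff_superset[OF fin])
      fix a assume "k a \<noteq> 0" "gps_coeff h (\<mu> - a) \<noteq> 0"
      then show "a \<in> ?A" using that[of a] m[of "\<mu> - a"] by auto
    qed
    have "gps_coeff ((f + g) * h) \<mu> =
        (\<Sum>a\<in>?A. (gps_coeff f a + gps_coeff g a) * gps_coeff h (\<mu> - a))"
      unfolding times_gps.rep_eq plus_gps.rep_eq by (rule *) auto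
    also have "\<dots> = gps_coeff (f * h) \<mu> + gps_coeff (g * h) \<mu>"
      using *[of "gps_coeff f"] *[of "gps_coeff g"]
      by (simp add: times_gps.rep_eq distrib_right sum.distrib)
    finally show "gps_coeff ((f + g) * h) \<mu> = gps_coeff (f * h + g * h) \<mu>"
      by (simp add: plus_gps.rep_eq)
  qed
  show "(0::gps) \<noteq> 1"
  proof
    assume "(0::gps) = 1"
    then have "gps_coeff 0 0 = gps_coeff 1 0" by simp
    then show False by (simp add: zero_gps.rep_eq one_gps_def gps_monom.rep_eq)
  qed
qed

end

text \<open>
  The series \<open>\<Sum>\<^bsub>i \<in> I\<^esub> c\<^sub>i z\<^bsup>e i\<^esup>\<close>, terms with equal exponents being collected. It is meaningful
  when each left half-plane contains \<open>e i\<close> for finitely many \<open>i \<in> I\<close> only.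
\<close>

definition gps_series :: "'i set \<Rightarrow> ('i \<Rightarrow> complex) \<Rightarrow> ('i \<Rightarrow> complex) \<Rightarrow> gps" where
  "gps_series I c e = Abs_gps (\<lambda>\<mu>. \<Sum>i | i \<in> I \<and> e i = \<mu>. c i)"

lemma gps_coeff_series:
  assumes "\<And>R. finite {i \<in> I. Re (e i) \<le> R}"
  shows "gps_coeff (gps_series I c e) \<mu> = (\<Sum>i | i \<in> I \<and> e i = \<mu>. c i)"
proof -
  have "finite {\<mu>. (\<Sum>i | i \<in> I \<and> e i = \<mu>. c i) \<noteq> 0 \<and> Re \<mu> \<le> R}" for R
  proof (rule finite_subset)
    show "finite (e ` {i \<in> I. Re (e i) \<le> R})" using assms by simp
    show "{\<mu>. (\<Sum>i | i \<in> I \<and> e i = \<mu>. c i) \<noteq> 0 \<and> Re \<mu> \<le> R} \<subseteq> e ` {i \<in> I. Re (e i) \<le> R}"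
    proof
      fix \<mu> assume *: "\<mu> \<in> {\<mu>. (\<Sum>i | i \<in> I \<and> e i = \<mu>. c i) \<noteq> 0 \<and> Re \<mu> \<le> R}"
      have "{i. i \<in> I \<and> e i = \<mu>} \<noteq> {}"
      proof
        assume "{i. i \<in> I \<and> e i = \<mu>} = {}"
        then have "(\<Sum>i | i \<in> I \<and> e i = \<mu>. c i) = 0" by (simp only: sum.empty)
        then show False using * by simp
      qed
      then show "\<mu> \<in> e ` {i \<in> I. Re (e i) \<le> R}" using * by auto
    qed
  qed
  then show ?thesis unfolding gps_series_def by (subst Abs_gps_inverse) auto
qed

text \<open>The exponents are pairwise distinct, i.e. equal powers have been collected.\<close>

definition gen_power_series :: "(nat \<Rightarrow> complex) \<Rightarrow> (nat \<Rightarrow> complex) \<Rightarrow> bool" where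
  "gen_power_series c \<mu> \<longleftrightarrow>
     c 0 \<noteq> 0 \<and> inj \<mu> \<and> (\<forall>j. Re (\<mu> j) \<le> Re (\<mu> (Suc j))) \<and>
     filterlim (\<lambda>j. Re (\<mu> j)) at_top sequentially"

lemma gen_power_series_finite:
  assumes "gen_power_series c \<mu>"
  shows "finite {j \<in> UNIV. Re (\<mu> j) \<le> R}"
proof -
  have "eventually (\<lambda>j. R < Re (\<mu> j)) sequentially"
    using assms unfolding gen_power_series_def filterlim_at_top_dense by blast
  then obtain N where "\<And>j. j \<ge> N \<Longrightarrow> R < Re (\<mu> j)" by (auto simp: eventually_sequentially)
  then have "{j \<in> UNIV. Re (\<mu> j) \<le> R} \<subseteq> {..<N}" by (force simp: not_le[symmetric])
  then show ?thesis by (rule finite_subset) simp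
qed


section \<open>The dilatation operator\<close>

text \<open>The logarithm with \<open>0 \<le> arg < 2\<pi>\<close>; the library's \<^const>\<open>Ln\<close> uses \<open>-\<pi> < arg \<le> \<pi>\<close>.\<close>

definition Ln2pi :: "complex \<Rightarrow> complex" where
  "Ln2pi q = Complex (ln (cmod q)) (Arg2pi q)"

lemma exp_Ln2pi:
  assumes "q \<noteq> 0"
  shows "exp (Ln2pi q) = q"
proof -
  have "exp (Ln2pi q) = of_real (cmod q) * cis (Arg2pi q)"
    using assms by (subst exp_eq_polar) (simp add: Ln2pi_def)
  also have "\<dots> = q"
    unfolding cis_conv_exp by (rule Arg2pi_eq[symmetric])
  finally show ?thesis .
qed

definition q_power :: "complex \<Rightarrow> complex \<Rightarrow> complex" where
  "q_power q \<mu> = exp (\<mu> * Ln2pi q)"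

lift_definition dilation :: "complex \<Rightarrow> gps \<Rightarrow> gps" is "\<lambda>q f \<mu>. q_power q \<mu> * f \<mu>"
  by (simp add: q_power_def)

text \<open>\<open>L(a\<sigma>) f\<close> for a polynomial \<open>L\<close> and a constant \<open>a\<close>.\<close>

definition poly_dilation :: "complex poly \<Rightarrow> complex \<Rightarrow> complex \<Rightarrow> gps \<Rightarrow> gps" where
  "poly_dilation L a q f =
     (\<Sum>k\<le>degree L. gps_monom (coeff L k * a ^ k) 0 * (dilation q ^^ k) f)"


section \<open>Polynomials in several variables\<close>

text \<open>
  Polynomials in variables indexed by \<^typ>\<open>nat\<close> are finitely supported functions from exponent
  vectors to coefficients.
\<close>

type_synonym mpoly = "(nat \<Rightarrow>\<^sub>0 nat) \<Rightarrow>\<^sub>0 complex"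

definition mpoly_vars :: "mpoly \<Rightarrow> nat set" where
  "mpoly_vars P = (\<Union>p\<in>Poly_Mapping.keys P. Poly_Mapping.keys p)"

definition power_product :: "(nat \<Rightarrow> gps) \<Rightarrow> (nat \<Rightarrow>\<^sub>0 nat) \<Rightarrow> gps" where
  "power_product x p = (\<Prod>i\<in>Poly_Mapping.keys p. x i ^ Poly_Mapping.lookup p i)"

definition mpoly_eval :: "mpoly \<Rightarrow> (nat \<Rightarrow> gps) \<Rightarrow> gps" where
  "mpoly_eval P x =
     (\<Sum>p\<in>Poly_Mapping.keys P. gps_monom (Poly_Mapping.lookup P p) 0 * power_product x p)"

definition mpoly_pderiv :: "nat \<Rightarrow> mpoly \<Rightarrow> mpoly" where
  "mpoly_pderiv v P =
     (\<Sum>p\<in>Poly_Mapping.keys P.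
        Poly_Mapping.single (p - Poly_Mapping.single v 1)
          (of_nat (Poly_Mapping.lookup p v) * Poly_Mapping.lookup P p))"

text \<open>
  \<open>P(z, f, \<sigma>f, \<sigma>\<^sup>2f, \<dots>)\<close>: variable \<open>0\<close> of \<open>P\<close> stands for \<open>z\<close>, variable \<open>Suc k\<close> for \<open>y\<^sub>k\<close>.
\<close>

definition qdiff_eval :: "complex \<Rightarrow> mpoly \<Rightarrow> gps \<Rightarrow> gps" where
  "qdiff_eval q P f =
     mpoly_eval P (\<lambda>i. case i of 0 \<Rightarrow> gps_monom 1 1 | Suc k \<Rightarrow> (dilation q ^^ k) f)"

text \<open>
  Finite linear combinations of \<open>z\<^sup>\<beta> u\<^sub>0\<^bsup>p\<^sub>0\<^esup> \<cdots> u\<^sub>n\<^bsup>p\<^sub>n\<^esup>\<close> with complex \<open>\<beta>\<close>, and their values at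
  \<open>u\<^sub>k = \<sigma>\<^sup>k f\<close>.
\<close>

type_synonym gen_mpoly = "(complex \<times> (nat \<Rightarrow>\<^sub>0 nat)) \<Rightarrow>\<^sub>0 complex"

definition gen_qdiff_eval :: "complex \<Rightarrow> gen_mpoly \<Rightarrow> gps \<Rightarrow> gps" where
  "gen_qdiff_eval q M f =
     (\<Sum>(\<beta>, p)\<in>Poly_Mapping.keys M.
        gps_monom (Poly_Mapping.lookup M (\<beta>, p)) \<beta> * power_product (\<lambda>k. (dilation q ^^ k) f) p)"


section \<open>Multi-indices\<close>

text \<open>
  \<open>\<int>\<^sub>+\<^sup>s \<setminus> {0}\<close>, with components numbered \<open>0, \<dots>, s - 1\<close>; the vanishing outside this range makes the
  representing function unique.
\<close>

definition nz_multi_indices :: "nat \<Rightarrow> (nat \<Rightarrow> nat) set" where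
  "nz_multi_indices s = {m. (\<forall>i\<ge>s. m i = 0) \<and> (\<exists>i<s. m i \<noteq> 0)}"

definition multi_comb :: "nat \<Rightarrow> (nat \<Rightarrow> complex) \<Rightarrow> (nat \<Rightarrow> nat) \<Rightarrow> complex" where
  "multi_comb s \<alpha> m = (\<Sum>i<s. of_nat (m i) * \<alpha> i)"

definition exponent_semigroup :: "nat \<Rightarrow> (nat \<Rightarrow> complex) \<Rightarrow> complex set" where
  "exponent_semigroup s \<alpha> = multi_comb s \<alpha> ` nz_multi_indices s"

lemma multi_comb_finite:
  assumes "\<And>i. i < s \<Longrightarrow> 0 < Re (\<alpha> i)"
  shows "finite {m \<in> nz_multi_indices s. Re (a + multi_comb s \<alpha> m) \<le> R}"
proof -
  define N where "N i = nat \<lceil>(R - Re a) / Re (\<alpha> i)\<rceil>" for i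
  have "{m \<in> nz_multi_indices s. Re (a + multi_comb s \<alpha> m) \<le> R} \<subseteq>
      {m. \<forall>i. (i \<in> {..<s} \<longrightarrow> m i \<in> {..Max (insert 0 (N ` {..<s}))}) \<and> (i \<notin> {..<s} \<longrightarrow> m i = 0)}"
  proof
    fix m assume m: "m \<in> {m \<in> nz_multi_indices s. Re (a + multi_comb s \<alpha> m) \<le> R}"
    have "m i \<le> Max (insert 0 (N ` {..<s}))" if i: "i < s" for i
    proof -
      have "real (m i) * Re (\<alpha> i) \<le> (\<Sum>i<s. real (m i) * Re (\<alpha> i))"
        using assms i by (intro member_le_sum) (auto simp: less_imp_le)
      also have "\<dots> \<le> R - Re a" using m by (simp add: multi_comb_def)
      finally have "real (m i) \<le> (R - Re a) / Re (\<alpha> i)"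
        using assms[OF i] by (simp add: field_simps)
      then have "m i \<le> N i" unfolding N_def by linarith
      also have "N i \<le> Max (insert 0 (N ` {..<s}))" using i by (intro Max_ge) auto
      finally show ?thesis .
    qed
    then show "m \<in> {m. \<forall>i. (i \<in> {..<s} \<longrightarrow> m i \<in> {..Max (insert 0 (N ` {..<s}))}) \<and>
        (i \<notin> {..<s} \<longrightarrow> m i = 0)}"
      using m by (auto simp: nz_multi_indices_def)
  qed
  then show ?thesis
    by (rule finite_subset) (intro finite_set_of_finite_funs; simp)
qed


section \<open>Convergence in sectors\<close>

text \<open>
  The open sector of radius \<open>r\<close> consisting of the points with an argument in \<open>(\<theta>\<^sub>1, \<theta>\<^sub>2)\<close>, and the
  corresponding sector of infinite radius.
\<close>

definition inf_sector :: "real \<Rightarrow> real \<Rightarrow> complex set" where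
  "inf_sector \<theta>\<^sub>1 \<theta>\<^sub>2 = {rcis \<rho> t | \<rho> t. 0 < \<rho> \<and> \<theta>\<^sub>1 < t \<and> t < \<theta>\<^sub>2}"

definition sector :: "real \<Rightarrow> real \<Rightarrow> real \<Rightarrow> complex set" where
  "sector \<theta>\<^sub>1 \<theta>\<^sub>2 r = inf_sector \<theta>\<^sub>1 \<theta>\<^sub>2 \<inter> ball 0 r"

definition log_branch_on :: "complex set \<Rightarrow> (complex \<Rightarrow> complex) \<Rightarrow> bool" where
  "log_branch_on S lg \<longleftrightarrow> continuous_on S lg \<and> (\<forall>z\<in>S. exp (lg z) = z)"

text \<open>
  For complex exponents the admissible radius depends on the direction and on the branch of the
  logarithm, since \<open>\<bar>z\<^sup>\<mu>\<bar> = \<bar>z\<bar>\<^bsup>Re \<mu>\<^esup> exp (- Im \<mu> arg z)\<close>.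
\<close>

definition converges_in_small_sectors :: "(nat \<Rightarrow> complex) \<Rightarrow> (nat \<Rightarrow> complex) \<Rightarrow> bool" where
  "converges_in_small_sectors c \<mu> \<longleftrightarrow>
     (\<forall>\<theta>\<^sub>1 \<theta>\<^sub>2 lg. \<theta>\<^sub>1 < \<theta>\<^sub>2 \<and> \<theta>\<^sub>2 - \<theta>\<^sub>1 < 2 * pi \<and> log_branch_on (inf_sector \<theta>\<^sub>1 \<theta>\<^sub>2) lg \<longrightarrow>
       (\<exists>r>0. \<exists>f. f holomorphic_on sector \<theta>\<^sub>1 \<theta>\<^sub>2 r \<and>
          uniform_limit (sector \<theta>\<^sub>1 \<theta>\<^sub>2 r)
            (\<lambda>N z. \<Sum>j<N. c j * exp (\<mu> j * lg z)) f sequentially))"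

end

theory Submission
  imports Defs "HOL-Complex_Analysis.Complex_Analysis"
    "HOL-Computational_Algebra.Fundamental_Theorem_Algebra"
begin

text \<open>
  Let \<open>d(y)\<close> be the coefficient of \<open>z\<^sup>y\<close> in \<open>\<psi>\<close>. Comparing coefficients in
  \<open>L(q\<^bsup>\<lambda>\<^esup>\<sigma>)\<psi> = M(z, \<psi>, \<dots>, \<sigma>\<^sup>n\<psi>)\<close> bounds \<open>|L(q\<^bsup>\<lambda> + y\<^esup>) d(y)|\<close> by a sum over the decompositions
  \<open>y = \<beta> + y\<^sub>1 + \<dots> + y\<^sub>l\<close> of the products of the \<open>D(y\<^sub>i) = max(1, |q\<^bsup>y\<^sub>i\<^esup>|)\<^sup>n |d(y\<^sub>i)|\<close>. Since \<open>deg L = n\<close>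
  and \<open>L(0) \<noteq> 0\<close>, \<open>|L(\<xi>)|\<close> is at least a constant times \<open>max(1, |\<xi>|)\<^sup>n\<close> times the product of the
  small divisors \<open>min(1, |\<xi>/a - 1|)\<close>, so that the recursion closes in \<open>D\<close>, no matter whether the
  \<open>|q\<^bsup>\<alpha>\<^sub>i\<^esup>|\<close> are large or small. If two divisors belonging to the same root \<open>a\<close> are small at \<open>y\<close> and
  \<open>y'\<close>, then \<open>q\<^bsup>y - y'\<^esup>\<close> is close to \<open>1\<close>, which the condition at the root \<open>q\<^bsup>\<lambda>\<^esup>\<close> forbids unless
  \<open>y - y'\<close> is large; hence, as in the arguments of Siegel and Bruno, the accumulated divisors are
  at most exponential in \<open>Re y\<close>. Dividing \<open>D\<close> by them leaves a recursion without small divisors,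
  whose weighted partial sums stay below \<open>1\<close>.
\<close>

section \<open>Counting small divisors\<close>

text \<open>Only these features of \<open>exponent_semigroup\<close> enter the counting and the
  recursion. Since \<open>0\<close> is not in \<open>G\<close>, having a difference in
  \<open>G\<close> is a strict order on \<open>G\<close>, along which \<open>Re\<close> changes by
  at least \<open>b\<close>.\<close>

locale discrete_semigroup =
  fixes G :: "complex set" and b :: real
  assumes add_closed: "x \<in> G \<Longrightarrow> y \<in> G \<Longrightarrow> x + y \<in> G"
    and b_pos: "0 < b"
    and Re_ge: "x \<in> G \<Longrightarrow> b \<le> Re x"
    and finite_below: "finite {x \<in> G. Re x \<le> R}"
begin

lemma Re_pos: "x \<in> G \<Longrightarrow> 0 < Re x"
  using Re_ge[of x] b_pos by linarith

text \<open>
  \<open>decomposition y ys\<close>: the exponent \<open>y\<close> arises in a product of terms with exponents \<open>ys\<close> and a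
  further factor \<open>z\<^sup>\<beta>\<close> with \<open>\<beta> \<in> G\<close>.
\<close>

definition decomposition :: "complex \<Rightarrow> complex list \<Rightarrow> bool" where
  "decomposition y ys \<longleftrightarrow> set ys \<subseteq> G \<and> y - sum_list ys \<in> G"

text \<open>The empty list is set apart because its sum \<open>0\<close> does not lie in
  \<open>G\<close>.\<close>

lemma sum_list_closed: "set ys \<subseteq> G \<Longrightarrow> ys = [] \<or> sum_list ys \<in> G"
  by (induction ys) (auto intro: add_closed)

text \<open>The difference consists of the other parts and of the extra exponent in
  \<open>G\<close>; the latter keeps it non-zero even when \<open>x\<close> is the only
  part.\<close>

lemma decomposition_diff:
  assumes "decomposition y ys" "x \<in> set ys"
  shows "y - x \<in> G"
proof -
  have eq: "sum_list ys = x + sum_list (remove1 x ys)"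
    using assms(2) by (rule sum_list_map_remove1[of x ys "\<lambda>x. x", simplified])
  have "set (remove1 x ys) \<subseteq> G"
    using assms(1) set_remove1_subset[of x ys] by (auto simp: decomposition_def)
  from sum_list_closed[OF this] show ?thesis
  proof
    assume "remove1 x ys = []"
    then show ?thesis using assms(1) eq by (simp add: decomposition_def)
  next
    assume "sum_list (remove1 x ys) \<in> G"
    then have "sum_list (remove1 x ys) + (y - sum_list ys) \<in> G"
      using assms(1) by (intro add_closed) (auto simp: decomposition_def)
    then show ?thesis by (simp add: eq)
  qed
qed

lemma Re_sum_list: "Re (sum_list ys) = (\<Sum>y\<leftarrow>ys. Re y)"
  by (induction ys) auto

lemma decomposition_in:
  assumes "decomposition y ys" shows "y \<in> G"
proof -
  have 1: "set ys \<subseteq> G" "y - sum_list ys \<in> G" using assms by (auto simp: decomposition_def)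
  from sum_list_closed[OF 1(1)] show ?thesis
  proof
    assume "ys = []" then show ?thesis using 1 by simp
  next
    assume "sum_list ys \<in> G"
    from add_closed[OF this 1(2)] show ?thesis by simp
  qed
qed

lemma decomposition_Re:
  assumes "decomposition y ys"
  shows "(\<Sum>x\<leftarrow>ys. Re x) \<le> Re y"
  using Re_pos[of "y - sum_list ys"] assms by (simp add: decomposition_def Re_sum_list)

text \<open>
  Let \<open>B\<close> be the set of exponents with a divisor below a threshold; two of them that differ by an
  element of \<open>G\<close> are at distance at least \<open>T\<close>. Bruno's bound \<open>2 Re y / T - 1\<close> for the number of
  their occurrences below \<open>y\<close> is sharpened by the distance from \<open>y\<close> down to \<open>B\<close>, truncated at
  \<open>T / 2\<close>, which makes the counting bound superadditive.
\<close>

definition gap :: "complex set \<Rightarrow> real \<Rightarrow> complex \<Rightarrow> real" where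
  "gap B T y = Inf (insert (T / 2) {Re (y - y') | y'. y' \<in> B \<and> (y = y' \<or> y - y' \<in> G)})"

definition count_bound :: "complex set \<Rightarrow> real \<Rightarrow> complex \<Rightarrow> real" where
  "count_bound B T y = (if T \<le> Re y - gap B T y then 2 * (Re y - gap B T y) / T - 1 else 0)"

context
  fixes B :: "complex set" and T :: real
  assumes T: "0 < T"
begin

lemma gap_bdd_below: "bdd_below (insert (T / 2) {Re (y - y') | y'. y' \<in> B \<and> (y = y' \<or> y - y' \<in> G)})"
proof (rule bdd_belowI[of _ 0])
  fix r assume "r \<in> insert (T / 2) {Re (y - y') | y'. y' \<in> B \<and> (y = y' \<or> y - y' \<in> G)}"
  then consider "r = T / 2" | y' where "r = Re (y - y')" "y = y' \<or> y - y' \<in> G" by auto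
  then show "0 \<le> r"
    using T Re_pos[of "y - y'" for y'] by cases (auto dest!: Re_pos)
qed

lemma gap_le_half: "gap B T y \<le> T / 2"
  unfolding gap_def by (intro cInf_lower gap_bdd_below) auto

lemma gap_le: "y' \<in> B \<Longrightarrow> y = y' \<or> y - y' \<in> G \<Longrightarrow> gap B T y \<le> Re (y - y')"
  unfolding gap_def by (intro cInf_lower gap_bdd_below) blast

lemma gap_greatest:
  assumes "r \<le> T / 2" "\<And>y'. y' \<in> B \<Longrightarrow> y = y' \<or> y - y' \<in> G \<Longrightarrow> r \<le> Re (y - y')"
  shows "r \<le> gap B T y"
  unfolding gap_def by (rule cInf_greatest) (use assms in auto)

lemma gap_nonneg: "0 \<le> gap B T y"
  using T by (intro gap_greatest) (auto dest!: Re_pos)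

lemma count_bound_nonneg: "0 \<le> count_bound B T y"
  using T by (simp add: count_bound_def field_simps)

lemma count_bound_le: "0 \<le> Re y \<Longrightarrow> count_bound B T y \<le> 2 * Re y / T"
  using T gap_nonneg[of y] by (auto simp: count_bound_def field_simps)

text \<open>Parts that are not \<open>big\<close> count \<open>0\<close> and are dropped. With no
  part left, a bad \<open>y\<close> (one in \<open>B\<close>) pays for itself because
  \<open>T \<le> Re y\<close>. With one part left, the gap at that part supplies the unit needed for
  a bad \<open>y\<close>, and otherwise the bound is monotone. With two or more left, their terms
  \<open>- 1\<close> suffice.\<close>

lemma count_bound_superadditive:
  assumes B: "\<And>y. y \<in> B \<Longrightarrow> y \<in> G \<Longrightarrow> T \<le> Re y"
      "\<And>y y'. y \<in> B \<Longrightarrow> y' \<in> B \<Longrightarrow> y - y' \<in> G \<Longrightarrow> T \<le> Re (y - y')"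
    and dec: "decomposition y ys"
  shows "of_bool (y \<in> B) + (\<Sum>x\<leftarrow>ys. count_bound B T x) \<le> count_bound B T y"
proof -
  define big where "big x \<longleftrightarrow> T \<le> Re x - gap B T x" for x
  define xs where "xs = filter big ys"
  have "(\<Sum>x\<leftarrow>ys. count_bound B T x) = (\<Sum>x\<leftarrow>xs. count_bound B T x)"
    unfolding xs_def by (induction ys) (auto simp: count_bound_def big_def)
  also have "\<dots> = (\<Sum>x\<leftarrow>xs. 2 * (Re x - gap B T x) / T - 1)"
    unfolding xs_def by (induction ys) (auto simp: count_bound_def big_def)
  finally have sum_eq: "(\<Sum>x\<leftarrow>ys. count_bound B T x) = (\<Sum>x\<leftarrow>xs. 2 * (Re x - gap B T x) / T - 1)" .
  have ysG: "set ys \<subseteq> G" using dec by (simp add: decomposition_def)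
  have yG: "y \<in> G" using dec by (rule decomposition_in)
  have "(\<Sum>x\<leftarrow>xs. Re x) \<le> (\<Sum>x\<leftarrow>ys. Re x)"
    unfolding xs_def using ysG Re_pos by (induction ys) (auto intro: less_imp_le add_increasing)
  also have "\<dots> \<le> Re y" using dec by (rule decomposition_Re)
  finally have Re_xs: "(\<Sum>x\<leftarrow>xs. Re x) \<le> Re y" .
  have big: "T \<le> Re x - gap B T x" if "x \<in> set xs" for x
    using that by (auto simp: xs_def big_def)
  \<comment> \<open>Every bad exponent below \<open>x\<close> is also below \<open>y\<close>, so in
    passing from \<open>y\<close> to \<open>x\<close> the gap shrinks by at most the
    distance.\<close>
  have child: "gap B T y - Re (y - x) \<le> gap B T x" if "x \<in> set xs" for x
  proof (rule gap_greatest)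
    have d: "y - x \<in> G" using dec that by (auto simp: xs_def intro: decomposition_diff)
    show "gap B T y - Re (y - x) \<le> T / 2" using gap_le_half[of y] Re_pos[OF d] by linarith
    fix y' assume y': "y' \<in> B" "x = y' \<or> x - y' \<in> G"
    then have "y - y' \<in> G" using d add_closed[of "x - y'" "y - x"] by auto
    then have "gap B T y \<le> Re (y - y')" using y' by (intro gap_le) auto
    then show "gap B T y - Re (y - x) \<le> Re (x - y')" by simp
  qed
  \<comment> \<open>If \<open>y\<close> is bad, the bad exponents below \<open>x\<close> are at
    distance at least \<open>T\<close> from \<open>y\<close>. Hence the gap at \<open>x\<close> is
    bounded below as if the gap at \<open>y\<close> were \<open>T / 2\<close>, although it is
    \<open>0\<close>.\<close>
  have child_bad: "T / 2 - Re (y - x) \<le> gap B T x" if "x \<in> set xs" "y \<in> B" for x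
  proof (rule gap_greatest)
    have d: "y - x \<in> G" using dec that by (auto simp: xs_def intro: decomposition_diff)
    show "T / 2 - Re (y - x) \<le> T / 2" using Re_pos[OF d] by linarith
    fix y' assume y': "y' \<in> B" "x = y' \<or> x - y' \<in> G"
    then have "y - y' \<in> G" using d add_closed[of "x - y'" "y - x"] by auto
    then have "T \<le> Re (y - y')" using B(2) that y' by blast
    then show "T / 2 - Re (y - x) \<le> Re (x - y')" using T by simp
  qed
  have bad: "gap B T y = 0" "count_bound B T y = 2 * Re y / T - 1" "T \<le> Re y" if "y \<in> B"
  proof -
    show "gap B T y = 0" using gap_le[of y y] gap_nonneg[of y] that by simp
    moreover show "T \<le> Re y" using B(1) that yG by blast
    ultimately show "count_bound B T y = 2 * Re y / T - 1" by (simp add: count_bound_def)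
  qed
  consider "xs = []" | x where "xs = [x]" | x x' zs where "xs = x # x' # zs"
    by (metis list.exhaust)
  then show ?thesis
  proof cases
    case 1
    show ?thesis
    proof (cases "y \<in> B")
      case True
      moreover have "1 \<le> Re y / T" using T bad(3)[OF True] by simp
      ultimately show ?thesis using bad(2) 1 by (simp add: sum_eq)
    qed (use 1 count_bound_nonneg[of y] in \<open>simp add: sum_eq\<close>)
  next
    case 2
    have bx: "T \<le> Re x - gap B T x" using big 2 by simp
    show ?thesis
    proof (cases "y \<in> B")
      case True
      have "T / 2 - Re (y - x) \<le> gap B T x" using child_bad 2 True by simp
      \<comment> \<open>After multiplication by \<open>2 / T\<close> the loss of
        \<open>T / 2\<close> is exactly the unit charged for \<open>y\<close>.\<close>
      then have "Re x - gap B T x \<le> Re y - T / 2" by simp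
      then have "2 * (Re x - gap B T x) / T \<le> 2 * (Re y - T / 2) / T" 
        using T by (intro divide_right_mono) auto
      also have "\<dots> = 2 * Re y / T - 1" using T by (simp add: field_simps)
      finally show ?thesis using True bad 2 by (simp add: sum_eq)
    next
      case False
      have le: "Re x - gap B T x \<le> Re y - gap B T y" using child[of x] 2 by simp
      then have "2 * (Re x - gap B T x) / T \<le> 2 * (Re y - gap B T y) / T"
        using T by (intro divide_right_mono) auto
      then show ?thesis unfolding sum_eq using False bx le 2 by (simp add: count_bound_def)
    qed
  next
    case 3
    \<comment> \<open>Here the gaps of the parts are thrown away; at least two terms
      \<open>- 1\<close> leave one unit to spare against \<open>2 * Re y / T - 1\<close>.\<close>
    have "(\<Sum>x\<leftarrow>xs. 2 * (Re x - gap B T x) / T - 1) \<le> (\<Sum>x\<leftarrow>xs. 2 / T * Re x - 1)"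
    proof (rule sum_list_mono)
      fix x show "2 * (Re x - gap B T x) / T - 1 \<le> 2 / T * Re x - 1"
        using T gap_nonneg[of x] by (simp add: field_simps)
    qed
    also have "\<dots> = 2 / T * (\<Sum>x\<leftarrow>xs. Re x) - real (length xs)"
      using T by (induction xs) (auto simp: field_simps)
    also have "\<dots> \<le> 2 / T * Re y - 2"
      using T Re_xs 3 by (intro diff_mono mult_left_mono) auto
    finally have le: "(\<Sum>x\<leftarrow>ys. count_bound B T x) \<le> 2 * Re y / T - 2" by (simp add: sum_eq)
    show ?thesis
    proof (cases "y \<in> B")
      case True
      then show ?thesis using le bad by simp
    next
      case False
      have Re_xx: "T \<le> Re x" "T \<le> Re x'"
        using big[of x] big[of x'] gap_nonneg[of x] gap_nonneg[of x'] 3 by auto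
      have "0 \<le> (\<Sum>x\<leftarrow>zs. Re x)"
      proof (rule sum_list_nonneg)
        fix r assume "r \<in> set (map Re zs)"
        then obtain u where "u \<in> set xs" "r = Re u" using 3 by auto
        then show "0 \<le> r" using big[of u] gap_nonneg[of u] T by auto
      qed
      then have "2 * T \<le> Re y" using Re_xs Re_xx 3 by simp
      then have ge: "T \<le> Re y - gap B T y" using gap_le_half[of y] T by simp
      \<comment> \<open>The truncation of the gap at \<open>T / 2\<close> limits its cost to the
        spare unit.\<close>
      have "2 * Re y / T - 2 \<le> 2 * (Re y - gap B T y) / T - 1"
        using gap_le_half[of y] T by (simp add: field_simps)
      then show ?thesis using le ge False by (simp add: count_bound_def)
    qed
  qed
qed

end

section \<open>From single thresholds to weights: summation over the dyadic scales\<close>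

definition total_bound :: "(nat \<Rightarrow> complex set) \<Rightarrow> complex \<Rightarrow> real" where
  "total_bound B y = suminf (\<lambda>k. count_bound (B k) (2 ^ k) y)"

text \<open>\<open>count_bound_le\<close> with \<open>T = 2 ^ k\<close> gives a geometric majorant.
  Linearity of the total in \<open>Re y\<close> is what later makes the accumulated divisors at most
  exponential.\<close>

lemma total_bound:
  fixes B :: "nat \<Rightarrow> complex set" and y :: complex
  assumes "0 \<le> Re y"
  shows "(\<lambda>k. count_bound (B k) (2 ^ k) y) sums total_bound B y"
    and "total_bound B y \<le> 4 * Re y"
proof -
  have le: "count_bound (B k) (2 ^ k) y \<le> 2 * Re y * (1 / 2) ^ k" for k
    using count_bound_le[of "2 ^ k" y "B k"] assms by (simp add: power_one_over)
  have geo: "summable (\<lambda>k. 2 * Re y * (1 / 2) ^ k :: real)"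
    by (intro summable_mult summable_geometric) simp
  have s: "summable (\<lambda>k. count_bound (B k) (2 ^ k) y)"
    by (rule summable_comparison_test'[OF geo, where N = 0]) (use le in \<open>simp add: count_bound_nonneg\<close>)
  then show "(\<lambda>k. count_bound (B k) (2 ^ k) y) sums total_bound B y"
    unfolding total_bound_def by (rule summable_sums)
  have "total_bound B y \<le> suminf (\<lambda>k. 2 * Re y * (1 / 2) ^ k)"
    unfolding total_bound_def by (intro suminf_le le s geo)
  also have "\<dots> = 4 * Re y"
    by (subst suminf_mult) (auto simp: suminf_geometric)
  finally show "total_bound B y \<le> 4 * Re y" .
qed

text \<open>An exponent lying in the first \<open>N\<close> of the sets is charged once for each of
  them, so the total measures the size of a divisor on a logarithmic scale.\<close>

lemma total_bound_superadditive:
  fixes B :: "nat \<Rightarrow> complex set"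
  assumes B: "\<And>k y. y \<in> B k \<Longrightarrow> y \<in> G \<Longrightarrow> 2 ^ k \<le> Re y"
      "\<And>k y y'. y \<in> B k \<Longrightarrow> y' \<in> B k \<Longrightarrow> y - y' \<in> G \<Longrightarrow> 2 ^ k \<le> Re (y - y')"
    and dec: "decomposition y ys" and N: "\<And>k. k < N \<Longrightarrow> y \<in> B k"
  shows "real N + (\<Sum>x\<leftarrow>ys. total_bound B x) \<le> total_bound B y"
proof -
  have ysG: "set ys \<subseteq> G" using dec by (simp add: decomposition_def)
  have sums: "(\<lambda>k. \<Sum>x\<leftarrow>ys. count_bound (B k) (2 ^ k) x) sums
      (\<Sum>x\<leftarrow>ys. total_bound B x)"
    using ysG by (induction ys)
      (auto intro!: sums_add total_bound(1) less_imp_le dest!: Re_pos)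
  have "(\<lambda>k. of_bool (k < N) :: real) sums real N"
    using sums_If_finite_set[of "{..<N}" "\<lambda>_. 1 :: real"] by (simp add: of_bool_def)
  from sums_add[OF this sums] show ?thesis
  proof (rule sums_le[rotated])
    show "(\<lambda>k. count_bound (B k) (2 ^ k) y) sums total_bound B y"
      using Re_pos[OF decomposition_in[OF dec]] by (intro total_bound(1)) simp
    fix k
    have "of_bool (y \<in> B k) + (\<Sum>x\<leftarrow>ys. count_bound (B k) (2 ^ k) x) \<le> count_bound (B k) (2 ^ k) y"
      by (rule count_bound_superadditive[OF _ B dec]) auto
    moreover have "of_bool (k < N) \<le> (of_bool (y \<in> B k) :: real)" using N by auto
    ultimately show "of_bool (k < N) + (\<Sum>x\<leftarrow>ys. count_bound (B k) (2 ^ k) x)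
        \<le> count_bound (B k) (2 ^ k) y" by linarith
  qed
qed

text \<open>\<open>W y\<close> stands for the accumulated reciprocals of the divisors
  \<open>\<epsilon>\<close>. The second clause says that dividing the weights of the parts by the
  new divisor \<open>\<epsilon> y\<close> yields at most \<open>K * W y\<close>.\<close>

definition siegel_weight :: "(complex \<Rightarrow> real) \<Rightarrow> (complex \<Rightarrow> real) \<Rightarrow> real \<Rightarrow> real \<Rightarrow> bool" where
  "siegel_weight \<epsilon> W K H \<longleftrightarrow>
     (\<forall>y\<in>G. 0 < W y \<and> W y \<le> H powr Re y) \<and>
     (\<forall>y ys. decomposition y ys \<longrightarrow> prod_list (map W ys) \<le> K * \<epsilon> y * W y)"

text \<open>\<open>B k\<close> collects the exponents with divisor below
  \<open>c0 * (2 ^ k) powr - \<nu>\<close>; \<open>low\<close> and \<open>sep\<close> give the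
  distances \<open>2 ^ k\<close> required by the counting. With \<open>W\<close> the exponential of
  the total count, superadditivity gains the factor \<open>2 powr (\<nu> * real N)\<close> if
  \<open>y\<close> lies in the first \<open>N\<close> sets, and this compensates
  \<open>\<epsilon> y\<close>.\<close>

lemma siegel_weight_exists:
  fixes \<epsilon> :: "complex \<Rightarrow> real"
  assumes c0: "0 < c0" and \<nu>: "0 < \<nu>"
    and low: "\<And>y. y \<in> G \<Longrightarrow> c0 * Re y powr - \<nu> \<le> \<epsilon> y"
    and sep: "\<And>y y'. y \<in> G \<Longrightarrow> y' \<in> G \<Longrightarrow> y - y' \<in> G \<Longrightarrow> c0 * Re (y - y') powr - \<nu> \<le> max (\<epsilon> y) (\<epsilon> y')"
  shows "\<exists>W K H. 0 < K \<and> 0 < H \<and> siegel_weight \<epsilon> W K H"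
proof -
  define B where "B k = {y \<in> G. \<epsilon> y < c0 * (2 ^ k) powr - \<nu>}" for k :: nat
  have powr_less: "2 ^ k \<le> r" if "c0 * r powr - \<nu> < c0 * (2 ^ k) powr - \<nu>" "0 < r" for r :: real and k :: nat
  proof (rule ccontr)
    assume "\<not> 2 ^ k \<le> r"
    then have "(2 ^ k) powr - \<nu> \<le> r powr - \<nu>"
      using that(2) \<nu> by (intro powr_mono2') auto
    then show False using that(1) c0 by simp
  qed
  have B1: "2 ^ k \<le> Re y" if "y \<in> B k" "y \<in> G" for k y
    using that low[of y] Re_pos[of y] by (intro powr_less) (auto simp: B_def)
  have B2: "2 ^ k \<le> Re (y - y')" if "y \<in> B k" "y' \<in> B k" "y - y' \<in> G" for k y y'
    using that sep[of y y'] Re_pos[of "y - y'"] by (intro powr_less) (auto simp: B_def)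
  have pos: "0 < \<epsilon> y" if "y \<in> G" for y
    using low[OF that] Re_pos[OF that] c0 by (smt (verit) mult_pos_pos powr_gt_zero)
  define E where "E = total_bound B"
  define W where "W y = 2 powr (\<nu> * E y)" for y
  have "W y \<le> (2 powr (4 * \<nu>)) powr Re y" if "y \<in> G" for y
  proof -
    have "\<nu> * E y \<le> \<nu> * (4 * Re y)"
      unfolding E_def using \<nu> Re_pos[OF that] by (intro mult_left_mono total_bound(2)) auto
    then show ?thesis unfolding W_def by (simp add: powr_powr mult_ac)
  qed
  moreover have "prod_list (map W ys) \<le> 1 / c0 * \<epsilon> y * W y" if dec: "decomposition y ys" for y ys
  proof -
    have yG: "y \<in> G" using dec by (rule decomposition_in)
    have "\<exists>k. 2 powr (\<nu> * real k) > c0 / \<epsilon> y"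
    proof -
      obtain k where "c0 / \<epsilon> y < (2 powr \<nu>) ^ k"
        using real_arch_pow[of "2 powr \<nu>"] \<nu> by auto
      then show ?thesis by (auto simp: powr_powr[symmetric] powr_realpow intro!: exI[of _ k])
    qed
    then obtain k where "c0 / \<epsilon> y < 2 powr (\<nu> * real k)" by blast
    have inB: "y \<in> B k \<longleftrightarrow> 2 powr (\<nu> * real k) < c0 / \<epsilon> y" for k
    proof -
      have "(2 ^ k) powr - \<nu> = inverse (2 powr (\<nu> * real k))"
        by (simp add: powr_realpow[symmetric] powr_powr powr_minus mult.commute)
      then show ?thesis
        unfolding B_def by (simp only: mem_Collect_eq) (use pos[OF yG] yG in \<open>simp add: field_simps\<close>)
    qed
    \<comment> \<open>\<open>N\<close> is the first threshold that \<open>y\<close> does not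
      undercut. It lies in all earlier sets, while \<open>y \<notin> B N\<close> bounds
      \<open>\<epsilon> y\<close> from below by
      \<open>c0 * 2 powr - (\<nu> * real N)\<close>.\<close>
    define N where "N = (LEAST k. y \<notin> B k)"
    have ex: "\<exists>k. y \<notin> B k" using \<open>c0 / \<epsilon> y < 2 powr (\<nu> * real k)\<close> inB by (auto intro!: exI[of _ k])
    have less_N: "y \<in> B k" if "k < N" for k using that not_less_Least unfolding N_def by blast
    have "y \<notin> B N" unfolding N_def using ex by (rule LeastI_ex)
    then have N_ge: "1 \<le> 2 powr (\<nu> * real N) * \<epsilon> y / c0"
      using inB[of N] pos[OF yG] c0 by (simp add: field_simps)
    have "prod_list (map W ys) = 2 powr (\<nu> * (\<Sum>x\<leftarrow>ys. E x))"
      by (induction ys) (auto simp: W_def powr_add algebra_simps)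
    also have "\<dots> \<le> 2 powr (\<nu> * (E y - real N))"
    proof -
      have "real N + (\<Sum>x\<leftarrow>ys. E x) \<le> E y"
        unfolding E_def by (rule total_bound_superadditive[OF B1 B2 dec less_N])
      then have "\<nu> * (\<Sum>x\<leftarrow>ys. E x) \<le> \<nu> * (E y - real N)"
        using \<nu> by (intro mult_left_mono) linarith+
      then show ?thesis by simp
    qed
    also have "\<dots> \<le> 2 powr (\<nu> * (E y - real N)) * (2 powr (\<nu> * real N) * \<epsilon> y / c0)"
      using mult_left_mono[OF N_ge, of "2 powr (\<nu> * (E y - real N))"] by simp
    also have "\<dots> = (2 powr (\<nu> * (E y - real N)) * 2 powr (\<nu> * real N)) * \<epsilon> y / c0"
      by simp
    also have "2 powr (\<nu> * (E y - real N)) * 2 powr (\<nu> * real N) = W y"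
      unfolding powr_add[symmetric] W_def by (simp add: right_diff_distrib)
    finally show ?thesis by (simp add: mult_ac)
  qed
  ultimately show ?thesis
    using c0 by (intro exI[of _ W] exI[of _ "1 / c0"] exI[of _ "2 powr (4 * \<nu>)"])
      (auto simp: siegel_weight_def W_def)
qed

text \<open>Separation is available only between divisors of the same root, so weights are built
  root by root and then multiplied. The multiset keeps track of multiplicities.\<close>

lemma siegel_weight_prod:
  assumes "\<And>a. a \<in># A \<Longrightarrow> \<exists>W K H. 0 < K \<and> 0 < H \<and> siegel_weight (\<epsilon> a) W K H"
    and "\<And>a y. a \<in># A \<Longrightarrow> y \<in> G \<Longrightarrow> 0 \<le> \<epsilon> a y"
  shows "\<exists>W K H. 0 < K \<and> 0 < H \<and> siegel_weight (\<lambda>y. \<Prod>a\<in>#A. \<epsilon> a y) W K H"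
  using assms
proof (induction A)
  case empty
  have "siegel_weight (\<lambda>y. 1) (\<lambda>_. 1) 1 1"
    by (simp add: siegel_weight_def map_replicate_const)
  then show ?case by (auto intro!: exI[of _ 1] exI[of _ "\<lambda>_. 1"])
next
  case (add a A)
  obtain W1 K1 H1 where 1: "0 < K1" "0 < H1" "siegel_weight (\<epsilon> a) W1 K1 H1"
    using add.prems(1)[of a] by auto
  obtain W2 K2 H2 where 2: "0 < K2" "0 < H2" "siegel_weight (\<lambda>y. \<Prod>a\<in>#A. \<epsilon> a y) W2 K2 H2"
    using add.IH add.prems by auto
  have W1: "0 < W1 y" "W1 y \<le> H1 powr Re y" if "y \<in> G" for y
    using 1(3) that by (auto simp: siegel_weight_def)
  have W2: "0 < W2 y" "W2 y \<le> H2 powr Re y" if "y \<in> G" for y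
    using 2(3) that by (auto simp: siegel_weight_def)
  have "siegel_weight (\<lambda>y. \<Prod>a\<in>#add_mset a A. \<epsilon> a y) (\<lambda>y. W1 y * W2 y) (K1 * K2) (H1 * H2)"
    unfolding siegel_weight_def
  proof (intro conjI ballI allI impI)
    fix y assume "y \<in> G"
    then show "0 < W1 y * W2 y" "W1 y * W2 y \<le> (H1 * H2) powr Re y"
      using W1[of y] W2[of y] 1(2) 2(2) by (auto simp: powr_mult intro!: mult_mono)
  next
    fix y ys assume dec: "decomposition y ys"
    have yG: "y \<in> G" using dec by (rule decomposition_in)
    have nn: "0 \<le> prod_list (map W2 ys)"
      using W2 dec by (intro prod_list_nonneg) (auto simp: decomposition_def less_imp_le)
    have "prod_list (map (\<lambda>y. W1 y * W2 y) ys) = prod_list (map W1 ys) * prod_list (map W2 ys)"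
      by (induction ys) auto
    also have "\<dots> \<le> (K1 * \<epsilon> a y * W1 y) * (K2 * (\<Prod>a\<in>#A. \<epsilon> a y) * W2 y)"
      using 1 2 dec nn W1[OF yG] add.prems(2)[of a y] yG
      by (intro mult_mono) (auto simp: siegel_weight_def)
    finally show "prod_list (map (\<lambda>y. W1 y * W2 y) ys) \<le> K1 * K2 * (\<Prod>a\<in>#add_mset a A. \<epsilon> a y) * (W1 y * W2 y)"
      by (simp add: mult_ac)
  qed
  then show ?case using 1 2 by (intro exI[of _ "\<lambda>y. W1 y * W2 y"] exI[of _ "K1 * K2"] exI[of _ "H1 * H2"]) auto
qed

end

section \<open>The majorant recursion\<close>

lemma gps_coeff_sum: "gps_coeff (sum f A) \<mu> = (\<Sum>a\<in>A. gps_coeff (f a) \<mu>)"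
  by (induction A rule: infinite_finite_induct) (auto simp: zero_gps.rep_eq plus_gps.rep_eq)

lemma gps_coeff_monom_mult: "gps_coeff (gps_monom c \<beta> * f) \<mu> = c * gps_coeff f (\<mu> - \<beta>)"
proof -
  have "gps_coeff (gps_monom c \<beta> * f) \<mu> = (\<Sum>a\<in>{\<beta>}. gps_coeff (gps_monom c \<beta>) a * gps_coeff f (\<mu> - a))"
    unfolding times_gps.rep_eq
    by (rule conv_coeff_superset) (auto simp: gps_monom.rep_eq split: if_splits)
  then show ?thesis by (simp add: gps_monom.rep_eq)
qed

lemma gps_coeff_dilation_power:
  "gps_coeff ((dilation q ^^ k) f) \<mu> = q_power q \<mu> ^ k * gps_coeff f \<mu>"
  by (induction k) (auto simp: dilation.rep_eq)

lemma gps_coeff_poly_dilation: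
  "gps_coeff (poly_dilation L a q f) \<mu> = poly L (a * q_power q \<mu>) * gps_coeff f \<mu>"
  unfolding poly_dilation_def gps_coeff_sum gps_coeff_monom_mult gps_coeff_dilation_power
    poly_altdef sum_distrib_right
  by (simp add: power_mult_distrib mult_ac)

text \<open>Listing the factors of a monomial with repetitions lets the coefficients of its value be
  indexed by lists of exponents, one entry per factor. The list does not depend on the values
  substituted.\<close>

lemma power_product_eq_prod_list:
  obtains ks where "set ks \<subseteq> Poly_Mapping.keys p" "\<And>x. power_product x p = prod_list (map x ks)"
proof -
  have "\<exists>ks. set ks \<subseteq> A \<and> (\<forall>x :: nat \<Rightarrow> gps. (\<Prod>i\<in>A. x i ^ Poly_Mapping.lookup p i) = prod_list (map x ks))"
    if "finite A" for A
    using that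
  proof induction
    case (insert a A)
    then obtain ks where "set ks \<subseteq> A"
        "\<And>x :: nat \<Rightarrow> gps. (\<Prod>i\<in>A. x i ^ Poly_Mapping.lookup p i) = prod_list (map x ks)" by blast
    then show ?case using insert.hyps
      by (intro exI[of _ "replicate (Poly_Mapping.lookup p a) a @ ks"]) (auto simp: set_replicate_conv_if)
  qed auto
  from this[OF finite_keys] show thesis using that unfolding power_product_def by blast
qed

section \<open>Sums over lists of fixed length\<close>

lemma sum_lists_Suc:
  "(\<Sum>ys | set ys \<subseteq> B \<and> length ys = Suc l \<and> P ys. h ys) =
   (\<Sum>(a, ys)\<in>(SIGMA a:B. {ys. set ys \<subseteq> B \<and> length ys = l \<and> P (a # ys)}). h (a # ys))"
  by (rule sum.reindex_bij_witness[of _ "\<lambda>(a, ys). a # ys" "\<lambda>ys. (hd ys, tl ys)"])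
     (auto simp: length_Suc_conv)

lemma sum_scaled:
  fixes c :: real
  shows "c * (\<Sum>i\<in>I. m i * (\<Sum>j\<in>A i. h i j)) = (\<Sum>i\<in>I. m i * (\<Sum>j\<in>A i. c * h i j))"
  by (simp add: sum_distrib_left mult.left_commute)

lemma sum_swap_scaled:
  fixes c :: real
  shows "(\<Sum>y\<in>Y. c * (\<Sum>i\<in>I. m i * h i y)) = c * (\<Sum>i\<in>I. m i * (\<Sum>y\<in>Y. h i y))"
proof -
  have "(\<Sum>y\<in>Y. \<Sum>i\<in>I. m i * h i y) = (\<Sum>i\<in>I. m i * (\<Sum>y\<in>Y. h i y))"
    by (subst sum.swap) (simp add: sum_distrib_left)
  then show ?thesis by (subst sum_distrib_left[symmetric]) simp
qed

lemma finite_lists_length_P: "finite B \<Longrightarrow> finite {ys. set ys \<subseteq> B \<and> length ys = l \<and> P ys}"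
  by (rule finite_subset[OF _ finite_lists_length_eq[of B l]]) auto

text \<open>By the distributive law; this turns the sum over all decompositions into a power of a
  partial sum.\<close>

lemma sum_prod_list_lists:
  fixes h :: "'a \<Rightarrow> real"
  assumes "finite B"
  shows "(\<Sum>ys | set ys \<subseteq> B \<and> length ys = l. prod_list (map h ys)) = sum h B ^ l"
proof (induction l)
  case 0
  have "{ys. set ys \<subseteq> B \<and> length ys = 0} = {[]}" by auto
  then show ?case by simp
next
  case (Suc l)
  have "(\<Sum>ys | set ys \<subseteq> B \<and> length ys = Suc l. prod_list (map h ys)) =
      (\<Sum>(a, ys)\<in>(SIGMA a:B. {ys. set ys \<subseteq> B \<and> length ys = l}). h a * prod_list (map h ys))"
    using sum_lists_Suc[where P = "\<lambda>_. True" and h = "\<lambda>ys. prod_list (map h ys)" and B = B and l = l]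
    by simp
  also have "\<dots> = (\<Sum>a\<in>B. \<Sum>ys | set ys \<subseteq> B \<and> length ys = l. h a * prod_list (map h ys))"
    using assms finite_lists_length_eq[OF assms] by (intro sum.Sigma[symmetric]) auto
  also have "\<dots> = sum h B ^ Suc l"
    by (simp add: sum_distrib_left[symmetric] Suc sum_distrib_right)
  finally show ?case .
qed

section \<open>Convolution estimate and majorant induction\<close>

context discrete_semigroup
begin

definition below :: "real \<Rightarrow> complex set" where
  "below R = {x \<in> G. Re x \<le> R}"

lemma finite_below': "finite (below R)"
  unfolding below_def by (rule finite_below)

definition supported :: "gps \<Rightarrow> bool" where
  "supported f \<longleftrightarrow> (\<forall>y. gps_coeff f y \<noteq> 0 \<longrightarrow> y \<in> G)"

text \<open>Iterated convolution. All exponents in \<open>G\<close> have positive real part, so no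
  part of \<open>y\<close> can exceed \<open>Re y\<close>, and finitely many lists with entries in
  \<open>below R\<close> suffice.\<close>

lemma norm_coeff_prod_list:
  fixes D :: "complex \<Rightarrow> real"
  assumes "\<And>f. f \<in> set fs \<Longrightarrow> supported f"
    and "\<And>f y. f \<in> set fs \<Longrightarrow> y \<in> G \<Longrightarrow> norm (gps_coeff f y) \<le> D y"
    and "Re y \<le> R"
  shows "norm (gps_coeff (prod_list fs) y) \<le>
    (\<Sum>ys | set ys \<subseteq> below R \<and> length ys = length fs \<and> sum_list ys = y. prod_list (map D ys))"
  using assms
proof (induction fs arbitrary: y)
  case Nil
  have "{ys. set ys \<subseteq> below R \<and> length ys = length [] \<and> sum_list ys = y} = (if y = 0 then {[]} else {})"
    for y :: complex by auto
  then show ?case by (auto simp: one_gps_def gps_monom.rep_eq)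
next
  case (Cons f fs)
  define h where "h y = (\<Sum>ys | set ys \<subseteq> below R \<and> length ys = length fs \<and> sum_list ys = y. prod_list (map D ys))" for y
  have f: "gps_coeff f a \<noteq> 0 \<Longrightarrow> a \<in> G" for a
    using Cons.prems(1)[of f] by (auto simp: supported_def)
  have IH: "norm (gps_coeff (prod_list fs) y) \<le> h y" if "Re y \<le> R" for y
    unfolding h_def using Cons.prems that by (intro Cons.IH) auto
  have D_nonneg: "0 \<le> D a" if "a \<in> G" for a
    using order_trans[OF norm_ge_zero Cons.prems(2)[of f a]] that by simp
  \<comment> \<open>The support of the tail is read off from the induction hypothesis: a non-zero
    coefficient needs at least one list in the bounding sum.\<close>
  have supp: "0 \<le> Re y" if "gps_coeff (prod_list fs) y \<noteq> 0" "Re y \<le> R" for y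
  proof -
    have "{ys. set ys \<subseteq> below R \<and> length ys = length fs \<and> sum_list ys = y} \<noteq> {}"
    proof
      assume e: "{ys. set ys \<subseteq> below R \<and> length ys = length fs \<and> sum_list ys = y} = {}"
      show False using IH[OF that(2)] that(1) unfolding h_def e by simp
    qed
    then obtain ys where ys: "set ys \<subseteq> G" "sum_list ys = y" by (auto simp: below_def)
    then show ?thesis using sum_list_closed[of ys] Re_pos[of y] by auto
  qed
  have "gps_coeff (prod_list (f # fs)) y = conv_coeff (gps_coeff f) (gps_coeff (prod_list fs)) y"
    by (simp add: times_gps.rep_eq)
  also have "\<dots> = (\<Sum>a\<in>below R. gps_coeff f a * gps_coeff (prod_list fs) (y - a))"
  proof (rule conv_coeff_superset[OF finite_below'])
    fix a assume a: "gps_coeff f a \<noteq> 0" "gps_coeff (prod_list fs) (y - a) \<noteq> 0"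
    then have "0 < Re a" using f Re_pos by blast
    then have "0 \<le> Re (y - a)" using supp[OF a(2)] Cons.prems(3) by simp
    then show "a \<in> below R" using f[OF a(1)] Cons.prems(3) by (simp add: below_def)
  qed
  finally have "norm (gps_coeff (prod_list (f # fs)) y) \<le>
      (\<Sum>a\<in>below R. norm (gps_coeff f a * gps_coeff (prod_list fs) (y - a)))"
    by (simp only: norm_sum)
  also have "\<dots> \<le> (\<Sum>a\<in>below R. D a * h (y - a))"
  proof (rule sum_mono)
    fix a assume "a \<in> below R"
    then have a: "a \<in> G" by (simp add: below_def)
    then show "norm (gps_coeff f a * gps_coeff (prod_list fs) (y - a)) \<le> D a * h (y - a)"
      unfolding norm_mult using Re_pos[OF a] Cons.prems(3) D_nonneg[OF a]
      by (intro mult_mono Cons.prems(2) IH) auto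
  qed
  also have "\<dots> = (\<Sum>a\<in>below R. \<Sum>ys | set ys \<subseteq> below R \<and> length ys = length fs \<and> sum_list ys = y - a.
      prod_list (map D (a # ys)))"
    by (simp add: h_def sum_distrib_left)
  also have "\<dots> = (\<Sum>(a, ys)\<in>(SIGMA a:below R. {ys. set ys \<subseteq> below R \<and> length ys = length fs \<and> sum_list (a # ys) = y}).
      prod_list (map D (a # ys)))"
    by (subst sum.Sigma) (auto simp: finite_below' finite_lists_length_P eq_diff_eq add.commute)
  also have "\<dots> = (\<Sum>ys | set ys \<subseteq> below R \<and> length ys = length (f # fs) \<and> sum_list ys = y. prod_list (map D ys))"
    by (subst list.size) (simp only: sum_lists_Suc add_0_right One_nat_def add_Suc_right)
  finally show ?case .
qed

text \<open>Dividing \<open>D\<close> by the weight removes the divisors from the recursion, and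
  every step through some \<open>\<beta> i\<close> gains \<open>x powr b\<close>. For small
  \<open>x\<close> the weighted partial sums stay below \<open>1\<close>, by induction over strips
  of width \<open>b\<close>: real parts up to \<open>R + b\<close> only involve parts up to
  \<open>R\<close>.\<close>

lemma majorant:
  fixes D \<epsilon> :: "complex \<Rightarrow> real" and \<beta> :: "'i \<Rightarrow> complex" and len :: "'i \<Rightarrow> nat" and m :: "'i \<Rightarrow> real"
  assumes I: "finite I" "\<And>i. i \<in> I \<Longrightarrow> \<beta> i \<in> G" "\<And>i. i \<in> I \<Longrightarrow> 0 \<le> m i"
    and D: "\<And>y. y \<in> G \<Longrightarrow> 0 \<le> D y"
    and \<epsilon>: "\<And>y. y \<in> G \<Longrightarrow> 0 < \<epsilon> y"
    and rec: "\<And>y R. y \<in> G \<Longrightarrow> Re y \<le> R + b \<Longrightarrow> \<epsilon> y * D y \<le>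
      (\<Sum>i\<in>I. m i * (\<Sum>ys | set ys \<subseteq> below R \<and> length ys = len i \<and> \<beta> i + sum_list ys = y. prod_list (map D ys)))"
    and W: "siegel_weight \<epsilon> W K H" "0 < K" "0 < H"
  shows "\<exists>x>0. \<forall>S. finite S \<and> S \<subseteq> G \<longrightarrow> (\<Sum>y\<in>S. D y * x powr Re y) \<le> 1"
proof -
  have W': "0 < W y" "W y \<le> H powr Re y" if "y \<in> G" for y
    using W(1) that by (auto simp: siegel_weight_def)
  define T where "T = sum m I"
  have T: "0 \<le> T" unfolding T_def using I by (intro sum_nonneg) auto
  \<comment> \<open>Chosen to make \<open>K * x powr b * T \<le> 1\<close>. The summand
    \<open>1\<close> in the denominator covers \<open>T = 0\<close> and ensures
    \<open>x \<le> 1\<close>, so that powers of \<open>x\<close> decrease in the exponent.\<close>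
  define x where "x = (1 / (1 + K * T)) powr (1 / b)"
  have KT: "1 \<le> 1 + K * T" using T W(2) by simp
  have x: "0 < x" "x \<le> 1"
    using KT b_pos by (auto simp: x_def intro!: powr_le1)
  have xb: "x powr b = 1 / (1 + K * T)" using b_pos KT by (simp add: x_def powr_powr)
  have KTx: "K * x powr b * T \<le> 1" unfolding xb using KT by (simp add: field_simps)
  define V where "V y = x powr Re y / W y" for y
  have V_nonneg: "0 \<le> V y" if "y \<in> G" for y using W'[OF that] by (simp add: V_def)
  \<comment> \<open>The weight inequality cancels the divisor, and \<open>b \<le> Re \<beta>\<close>
    yields the small factor \<open>x powr b\<close>.\<close>
  have V_step: "V y / \<epsilon> y \<le> K * x powr b * prod_list (map V ys)"
    if ys: "set ys \<subseteq> G" "\<beta> + sum_list ys = y" "\<beta> \<in> G" for y ys \<beta>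
  proof -
    have "y - sum_list ys = \<beta>" using ys(2) by (simp add: algebra_simps)
    then have dec: "decomposition y ys" using ys by (simp add: decomposition_def)
    have yG: "y \<in> G" using dec by (rule decomposition_in)
    have prodV: "prod_list (map V ys) = x powr Re (sum_list ys) / prod_list (map W ys)"
      using x by (induction ys) (auto simp: V_def powr_add)
    have prodW: "0 < prod_list (map W ys)"
      using ys(1) W' by (induction ys) auto
    have "prod_list (map W ys) \<le> K * \<epsilon> y * W y"
      using W(1) dec by (simp add: siegel_weight_def)
    then have 1: "1 / (\<epsilon> y * W y) \<le> K / prod_list (map W ys)"
      using prodW \<epsilon>[OF yG] W'[OF yG] by (simp add: field_simps)
    have "x powr Re y = x powr Re \<beta> * x powr Re (sum_list ys)"
      using ys(2) x by (auto simp: powr_add[symmetric])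
    also have "\<dots> \<le> x powr b * x powr Re (sum_list ys)"
      using x Re_ge[OF ys(3)] by (intro mult_right_mono powr_mono') auto
    finally have 2: "x powr Re y \<le> x powr b * x powr Re (sum_list ys)" .
    have "V y / \<epsilon> y = x powr Re y * (1 / (\<epsilon> y * W y))" by (simp add: V_def)
    also have "\<dots> \<le> (x powr b * x powr Re (sum_list ys)) * (K / prod_list (map W ys))"
      using 1 2 \<epsilon>[OF yG] W'[OF yG] by (intro mult_mono) auto
    also have "\<dots> = K * x powr b * prod_list (map V ys)" by (simp add: prodV)
    finally show ?thesis .
  qed
  define U where "U y = D y * V y" for y
  have U_nonneg: "0 \<le> U y" if "y \<in> G" for y
    using D[OF that] V_nonneg[OF that] by (simp add: U_def)
  have prodU: "prod_list (map U ys) = prod_list (map D ys) * prod_list (map V ys)" for ys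
    by (induction ys) (auto simp: U_def)
  have prodU_nonneg: "0 \<le> prod_list (map U ys)" if "set ys \<subseteq> G" for ys
    using that U_nonneg by (intro prod_list_nonneg) auto
  have U_step: "U y \<le> K * x powr b *
      (\<Sum>i\<in>I. m i * (\<Sum>ys | set ys \<subseteq> below R \<and> length ys = len i \<and> \<beta> i + sum_list ys = y. prod_list (map U ys)))"
    if y: "y \<in> G" "Re y \<le> R + b" for y R
  proof -
    have "U y = (\<epsilon> y * D y) * (V y / \<epsilon> y)" using \<epsilon>[OF y(1)] by (simp add: U_def)
    also have "\<dots> \<le> (\<Sum>i\<in>I. m i * (\<Sum>ys | set ys \<subseteq> below R \<and> length ys = len i \<and> \<beta> i + sum_list ys = y.
        prod_list (map D ys))) * (V y / \<epsilon> y)"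
      using rec[OF y] V_nonneg[OF y(1)] \<epsilon>[OF y(1)] by (intro mult_right_mono) auto
    also have "\<dots> = (\<Sum>i\<in>I. m i * (\<Sum>ys | set ys \<subseteq> below R \<and> length ys = len i \<and> \<beta> i + sum_list ys = y.
        (V y / \<epsilon> y) * prod_list (map D ys)))"
      by (subst mult.commute) (rule sum_scaled)
    also have "\<dots> \<le> (\<Sum>i\<in>I. m i * (\<Sum>ys | set ys \<subseteq> below R \<and> length ys = len i \<and> \<beta> i + sum_list ys = y.
        K * x powr b * prod_list (map U ys)))"
    proof (intro sum_mono mult_left_mono I(3))
      fix i ys assume i: "i \<in> I"
        and ys: "ys \<in> {ys. set ys \<subseteq> below R \<and> length ys = len i \<and> \<beta> i + sum_list ys = y}"
      then have ysG: "set ys \<subseteq> G" by (auto simp: below_def)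
      have "prod_list (map D ys) * (V y / \<epsilon> y) \<le> prod_list (map D ys) * (K * x powr b * prod_list (map V ys))"
        using ysG D ys I(2)[OF i] by (intro mult_left_mono V_step prod_list_nonneg) auto
      then show "(V y / \<epsilon> y) * prod_list (map D ys) \<le> K * x powr b * prod_list (map U ys)"
        by (simp add: prodU mult_ac)
    qed
    also have "\<dots> = K * x powr b * (\<Sum>i\<in>I. m i * (\<Sum>ys | set ys \<subseteq> below R \<and> length ys = len i \<and> \<beta> i + sum_list ys = y.
        prod_list (map U ys)))"
      by (rule sum_scaled[symmetric])
    finally show ?thesis .
  qed
  have main: "(\<Sum>y\<in>below (real N * b). U y) \<le> 1" for N
  proof (induction N)
    case 0
    have "below (real 0 * b) = {}" using Re_pos by (auto simp: below_def not_le)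
    then show ?case by simp
  next
    case (Suc N)
    let ?R = "real N * b"
    let ?L = "\<lambda>i. {ys. set ys \<subseteq> below ?R \<and> length ys = len i}"
    have finL: "finite (?L i)" for i using finite_below' by (rule finite_lists_length_eq)
    \<comment> \<open>A list \<open>ys\<close> determines its \<open>y\<close>, so after the
      exchange of sums each list is counted at most once. All lists together give a power of the
      previous partial sum, which is at most \<open>1\<close>.\<close>
    have inner: "(\<Sum>y\<in>below (real (Suc N) * b). \<Sum>ys | set ys \<subseteq> below ?R \<and> length ys = len i \<and> \<beta> i + sum_list ys = y.
        prod_list (map U ys)) \<le> 1" for i
    proof -
      have "(\<Sum>y\<in>below (real (Suc N) * b). \<Sum>ys | set ys \<subseteq> below ?R \<and> length ys = len i \<and> \<beta> i + sum_list ys = y.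
          prod_list (map U ys)) =
          (\<Sum>y\<in>below (real (Suc N) * b). \<Sum>ys\<in>?L i. if \<beta> i + sum_list ys = y then prod_list (map U ys) else 0)"
      proof (rule sum.cong[OF refl])
        fix y
        have "{ys. set ys \<subseteq> below ?R \<and> length ys = len i \<and> \<beta> i + sum_list ys = y} =
            {ys \<in> ?L i. \<beta> i + sum_list ys = y}" by auto
        then show "(\<Sum>ys | set ys \<subseteq> below ?R \<and> length ys = len i \<and> \<beta> i + sum_list ys = y. prod_list (map U ys)) =
            (\<Sum>ys\<in>?L i. if \<beta> i + sum_list ys = y then prod_list (map U ys) else 0)"
          by (simp only: sum.inter_filter[OF finL])
      qed
      also have "\<dots> = (\<Sum>ys\<in>?L i. \<Sum>y\<in>below (real (Suc N) * b). if \<beta> i + sum_list ys = y then prod_list (map U ys) else 0)"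
        by (rule sum.swap)
      also have "\<dots> \<le> (\<Sum>ys\<in>?L i. prod_list (map U ys))"
      proof (rule sum_mono)
        fix ys assume "ys \<in> ?L i"
        then have "0 \<le> prod_list (map U ys)" by (intro prodU_nonneg) (auto simp: below_def)
        then show "(\<Sum>y\<in>below (real (Suc N) * b). if \<beta> i + sum_list ys = y then prod_list (map U ys) else 0)
            \<le> prod_list (map U ys)"
          by (simp add: finite_below')
      qed
      also have "\<dots> = (\<Sum>y\<in>below ?R. U y) ^ len i" by (rule sum_prod_list_lists[OF finite_below'])
      also have "\<dots> \<le> 1"
        using Suc U_nonneg by (intro power_le_one sum_nonneg) (auto simp: below_def)
      finally show ?thesis .
    qed
    have "(\<Sum>y\<in>below (real (Suc N) * b). U y) \<le> (\<Sum>y\<in>below (real (Suc N) * b). K * x powr b *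
        (\<Sum>i\<in>I. m i * (\<Sum>ys | set ys \<subseteq> below ?R \<and> length ys = len i \<and> \<beta> i + sum_list ys = y. prod_list (map U ys))))"
      by (intro sum_mono U_step) (auto simp: below_def algebra_simps)
    also have "\<dots> = K * x powr b * (\<Sum>i\<in>I. m i * (\<Sum>y\<in>below (real (Suc N) * b).
        \<Sum>ys | set ys \<subseteq> below ?R \<and> length ys = len i \<and> \<beta> i + sum_list ys = y. prod_list (map U ys)))"
      by (rule sum_swap_scaled)
    also have "\<dots> \<le> K * x powr b * (\<Sum>i\<in>I. m i * 1)"
      using I W(2) by (intro mult_left_mono sum_mono inner) auto
    also have "\<dots> \<le> 1" using KTx by (simp add: T_def)
    finally show ?case .
  qed
  \<comment> \<open>The weight is removed again: as \<open>W y \<le> H powr Re y\<close>, replacing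
    \<open>x\<close> by \<open>x / H\<close> compensates for it.\<close>
  have "(\<Sum>y\<in>S. D y * (x / H) powr Re y) \<le> 1" if S: "finite S" "S \<subseteq> G" for S
  proof -
    obtain N where N: "\<And>y. y \<in> S \<Longrightarrow> Re y \<le> real N * b"
    proof -
      obtain N where "Max (insert 0 (Re ` S)) / b \<le> real N" using real_arch_simple by blast
      then have "Re y \<le> real N * b" if "y \<in> S" for y
        using that S(1) b_pos Max_ge[of "insert 0 (Re ` S)" "Re y"] by (simp add: field_simps)
      then show thesis using that by blast
    qed
    have "(\<Sum>y\<in>S. D y * (x / H) powr Re y) \<le> (\<Sum>y\<in>S. U y)"
    proof (rule sum_mono)
      fix y assume "y \<in> S"
      then have y: "y \<in> G" using S by auto
      have "(x / H) powr Re y = x powr Re y / H powr Re y" using x W(3) by (simp add: powr_divide)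
      also have "\<dots> \<le> V y"
        unfolding V_def using W'[OF y] x W(3) by (intro divide_left_mono) auto
      finally show "D y * (x / H) powr Re y \<le> U y"
        unfolding U_def using D[OF y] by (intro mult_left_mono)
    qed
    also have "\<dots> \<le> (\<Sum>y\<in>below (real N * b). U y)"
      using N S U_nonneg by (intro sum_mono2 finite_below') (auto simp: below_def)
    also have "\<dots> \<le> 1" by (rule main)
    finally show ?thesis .
  qed
  then show ?thesis using x W(3) by (intro exI[of _ "x / H"]) auto
qed

end

section \<open>Bounds for the coefficients\<close>

text \<open>The bound by \<open>b\<close> turns the Diophantine condition in the length of
  \<open>m\<close> into one in \<open>Re y\<close>. The cone condition controls the imaginary parts
  of exponents when powers of \<open>z\<close> are estimated in a sector.\<close>

lemma exponent_semigroup_discrete: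
  assumes alphas: "\<And>i. i < s \<Longrightarrow> 0 < Re (\<alpha>s i)"
  obtains b \<kappa> where "discrete_semigroup (exponent_semigroup s \<alpha>s) b" "0 \<le> \<kappa>"
    "\<And>m. m \<in> nz_multi_indices s \<Longrightarrow> 1 \<le> (\<Sum>i<s. m i) \<and> b * real (\<Sum>i<s. m i) \<le> Re (multi_comb s \<alpha>s m)"
    "\<And>y. y \<in> exponent_semigroup s \<alpha>s \<Longrightarrow> \<bar>Im y\<bar> \<le> \<kappa> * Re y"
proof -
  \<comment> \<open>The element \<open>1\<close> keeps the minimum meaningful for
    \<open>s = 0\<close>.\<close>
  define b where "b = Min (insert 1 ((\<lambda>i. Re (\<alpha>s i)) ` {..<s}))"
  have b_pos: "0 < b" using alphas by (auto simp: b_def)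
  have b_le: "b \<le> Re (\<alpha>s i)" if "i < s" for i using that by (auto simp: b_def)
  define \<kappa> where "\<kappa> = (\<Sum>i<s. \<bar>Im (\<alpha>s i)\<bar>) / b"
  have pos: "1 \<le> (\<Sum>i<s. m i)" if m: "m \<in> nz_multi_indices s" for m
  proof -
    obtain i where i: "i < s" "m i \<noteq> 0" using m by (auto simp: nz_multi_indices_def)
    then show ?thesis using member_le_sum[of i "{..<s}" m] by auto
  qed
  have Re_le: "b * real (\<Sum>i<s. m i) \<le> Re (multi_comb s \<alpha>s m)" for m
  proof -
    have "(\<Sum>i<s. real (m i) * b) \<le> (\<Sum>i<s. real (m i) * Re (\<alpha>s i))"
      by (intro sum_mono mult_left_mono b_le) auto
    then show ?thesis by (simp add: multi_comb_def sum_distrib_left mult.commute)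
  qed
  have Im_le: "\<bar>Im y\<bar> \<le> \<kappa> * Re y" if y: "y \<in> exponent_semigroup s \<alpha>s" for y
  proof -
    obtain m where m: "y = multi_comb s \<alpha>s m" using y by (auto simp: exponent_semigroup_def)
    have "\<bar>Im y\<bar> \<le> (\<Sum>i<s. \<bar>real (m i) * Im (\<alpha>s i)\<bar>)"
      unfolding m multi_comb_def by simp
    also have "\<dots> \<le> (\<Sum>i<s. real (\<Sum>i<s. m i) * \<bar>Im (\<alpha>s i)\<bar>)"
    proof (rule sum_mono)
      fix i assume "i \<in> {..<s}"
      then have "m i \<le> (\<Sum>i<s. m i)" by (intro member_le_sum) auto
      then show "\<bar>real (m i) * Im (\<alpha>s i)\<bar> \<le> real (\<Sum>i<s. m i) * \<bar>Im (\<alpha>s i)\<bar>"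
        unfolding abs_mult by (intro mult_right_mono) (simp_all del: of_nat_sum)
    qed
    also have "\<dots> = \<kappa> * (b * real (\<Sum>i<s. m i))"
      by (subst sum_distrib_left[symmetric]) (use b_pos in \<open>simp add: \<kappa>_def\<close>)
    also have "\<dots> \<le> \<kappa> * Re y"
      unfolding m using b_pos by (intro mult_left_mono Re_le) (auto simp: \<kappa>_def sum_nonneg)
    finally show ?thesis .
  qed
  have "discrete_semigroup (exponent_semigroup s \<alpha>s) b"
  proof
    fix x y assume "x \<in> exponent_semigroup s \<alpha>s" "y \<in> exponent_semigroup s \<alpha>s"
    then obtain m m' where m: "x = multi_comb s \<alpha>s m" "m \<in> nz_multi_indices s"
        "y = multi_comb s \<alpha>s m'" "m' \<in> nz_multi_indices s"
      by (auto simp: exponent_semigroup_def)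
    then have "x + y = multi_comb s \<alpha>s (\<lambda>i. m i + m' i)" "(\<lambda>i. m i + m' i) \<in> nz_multi_indices s"
      by (auto simp: multi_comb_def nz_multi_indices_def sum.distrib distrib_right)
    then show "x + y \<in> exponent_semigroup s \<alpha>s" by (auto simp: exponent_semigroup_def)
  next
    fix x assume "x \<in> exponent_semigroup s \<alpha>s"
    then obtain m where m: "x = multi_comb s \<alpha>s m" "m \<in> nz_multi_indices s"
      by (auto simp: exponent_semigroup_def)
    have "b * 1 \<le> b * real (\<Sum>i<s. m i)"
      using pos[OF m(2)] b_pos by (intro mult_left_mono) (simp_all del: of_nat_sum)
    then show "b \<le> Re x" using Re_le[of m] m by simp
  next
    fix R
    have "{x \<in> exponent_semigroup s \<alpha>s. Re x \<le> R} \<subseteq>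
        multi_comb s \<alpha>s ` {m \<in> nz_multi_indices s. Re (0 + multi_comb s \<alpha>s m) \<le> R}"
      by (auto simp: exponent_semigroup_def)
    then show "finite {x \<in> exponent_semigroup s \<alpha>s. Re x \<le> R}"
      using multi_comb_finite[of s \<alpha>s 0 R] alphas by (auto intro: finite_subset)
  qed (rule b_pos)
  then show thesis
    using that[of b \<kappa>] pos Re_le Im_le b_pos by (auto simp: \<kappa>_def sum_nonneg)
qed

text \<open>With \<open>u = \<xi> / a\<close>: either \<open>u\<close> is within distance
  \<open>1\<close> of \<open>1\<close> and then \<open>cmod u \<le> 2\<close>, or
  \<open>cmod u\<close> is at most twice \<open>cmod (u - 1)\<close>. So a factor of
  \<open>L\<close> is small only near its root and grows linearly elsewhere.\<close>

lemma norm_diff_lower_bound: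
  fixes a \<xi> :: complex
  assumes "a \<noteq> 0"
  shows "min (cmod a) 1 / 2 * max 1 (cmod \<xi>) * min 1 (cmod (\<xi> / a - 1)) \<le> cmod (\<xi> - a)"
proof -
  define u where "u = \<xi> / a"
  have \<xi>: "\<xi> = a * u" using assms by (simp add: u_def)
  have tri: "cmod u \<le> 1 + cmod (u - 1)" using norm_triangle_ineq[of 1 "u - 1"] by simp
  have key: "max 1 (cmod u) * min 1 (cmod (u - 1)) \<le> 2 * cmod (u - 1)"
  proof (cases "cmod (u - 1) \<le> 1")
    case True
    then have "max 1 (cmod u) * cmod (u - 1) \<le> 2 * cmod (u - 1)"
      using tri by (intro mult_right_mono) auto
    then show ?thesis using True by (simp add: min_def)
  qed (use tri in \<open>auto simp: min_def max_def\<close>)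
  have "min (cmod a) 1 * max 1 (cmod \<xi>) \<le> cmod a * max 1 (cmod u)"
  proof (cases "1 \<le> cmod \<xi>")
    case True
    have "min (cmod a) 1 * cmod \<xi> \<le> 1 * cmod \<xi>" by (intro mult_right_mono) auto
    also have "\<dots> \<le> cmod a * max 1 (cmod u)" by (auto simp: \<xi> norm_mult intro!: mult_left_mono)
    finally show ?thesis using True by (simp add: max_def)
  next
    case False
    have "min (cmod a) 1 \<le> cmod a * 1" by simp
    also have "\<dots> \<le> cmod a * max 1 (cmod u)" by (intro mult_left_mono) auto
    finally show ?thesis using False by (simp add: max_def)
  qed
  then have "min (cmod a) 1 * max 1 (cmod \<xi>) * min 1 (cmod (u - 1)) \<le>
      cmod a * max 1 (cmod u) * min 1 (cmod (u - 1))"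
    by (intro mult_right_mono) auto
  also have "\<dots> \<le> cmod a * (2 * cmod (u - 1))"
    using mult_left_mono[OF key, of "cmod a"] by (simp add: mult.assoc)
  also have "\<dots> = 2 * cmod (\<xi> - a)"
    by (simp add: \<xi> norm_mult[symmetric] right_diff_distrib)
  finally show ?thesis by (simp add: u_def)
qed

text \<open>The preceding bound is multiplied over the linear factors, \<open>A\<close> being the
  multiset of roots; \<open>L(0) \<noteq> 0\<close> makes all of them non-zero. Each factor
  contributes one power of \<open>max 1 (cmod \<xi>)\<close>.\<close>

lemma poly_lower_bound:
  fixes L :: "complex poly"
  assumes "poly L 0 \<noteq> 0"
  obtains A \<kappa> where "0 < \<kappa>" "\<And>a. a \<in># A \<Longrightarrow> poly L a = 0"
    "\<And>\<xi>. \<kappa> * max 1 (cmod \<xi>) ^ degree L * (\<Prod>a\<in>#A. min 1 (cmod (\<xi> / a - 1))) \<le> cmod (poly L \<xi>)"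
proof -
  have L: "L \<noteq> 0" using assms by auto
  obtain A where A: "size A = degree L" "L = smult (lead_coeff L) (\<Prod>x\<in>#A. [:-x, 1:])"
    using alg_closed_imp_factorization[OF L] by (elim exE conjE) (rule that)
  have poly_L: "poly L \<xi> = lead_coeff L * (\<Prod>a\<in>#A. \<xi> - a)" for \<xi>
    by (subst A(2)) (simp add: poly_prod_mset image_mset.compositionality o_def)
  have roots: "poly L a = 0" if "a \<in># A" for a
    using that by (auto simp: poly_L prod_mset_zero_iff)
  then have "0 \<notin># A" using assms by auto
  then have "\<exists>\<kappa>>0. \<forall>\<xi>. \<kappa> * max 1 (cmod \<xi>) ^ size A * (\<Prod>a\<in>#A. min 1 (cmod (\<xi> / a - 1))) \<le>
      cmod (\<Prod>a\<in>#A. \<xi> - a)"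
  proof (induction A)
    case empty
    show ?case by (auto intro!: exI[of _ 1])
  next
    case (add a A)
    then obtain \<kappa> where \<kappa>: "0 < \<kappa>" "\<And>\<xi>. \<kappa> * max 1 (cmod \<xi>) ^ size A * (\<Prod>a\<in>#A. min 1 (cmod (\<xi> / a - 1))) \<le>
      cmod (\<Prod>a\<in>#A. \<xi> - a)" by auto
    have "a \<noteq> 0" using add.prems by auto
    have "(min (cmod a) 1 / 2 * \<kappa>) * max 1 (cmod \<xi>) ^ size (add_mset a A) *
        (\<Prod>a\<in>#add_mset a A. min 1 (cmod (\<xi> / a - 1))) \<le> cmod (\<Prod>a\<in>#add_mset a A. \<xi> - a)" for \<xi>
    proof -
      have nn: "0 \<le> (\<Prod>a\<in>#A. min 1 (cmod (\<xi> / a - 1)))" by (induction A) auto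
      have "(min (cmod a) 1 / 2 * max 1 (cmod \<xi>) * min 1 (cmod (\<xi> / a - 1))) *
          (\<kappa> * max 1 (cmod \<xi>) ^ size A * (\<Prod>a\<in>#A. min 1 (cmod (\<xi> / a - 1)))) \<le>
          cmod (\<xi> - a) * cmod (\<Prod>a\<in>#A. \<xi> - a)"
        using \<kappa> nn by (intro mult_mono norm_diff_lower_bound[OF \<open>a \<noteq> 0\<close>]) auto
      then show ?thesis by (simp add: norm_mult mult_ac)
    qed
    then show ?case using \<kappa>(1) \<open>a \<noteq> 0\<close> by (intro exI[of _ "min (cmod a) 1 / 2 * \<kappa>"]) auto
  qed
  then obtain \<kappa> where \<kappa>: "0 < \<kappa>" "\<And>\<xi>. \<kappa> * max 1 (cmod \<xi>) ^ degree L * (\<Prod>a\<in>#A. min 1 (cmod (\<xi> / a - 1))) \<le>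
      cmod (\<Prod>a\<in>#A. \<xi> - a)" unfolding A(1) by auto
  show thesis
  proof (rule that[of "cmod (lead_coeff L) * \<kappa>" A])
    fix \<xi>
    show "cmod (lead_coeff L) * \<kappa> * max 1 (cmod \<xi>) ^ degree L * (\<Prod>a\<in>#A. min 1 (cmod (\<xi> / a - 1))) \<le> cmod (poly L \<xi>)"
      using mult_left_mono[OF \<kappa>(2)[of \<xi>], of "cmod (lead_coeff L)"]
      by (simp add: poly_L norm_mult mult.assoc)
  qed (use \<kappa>(1) L roots in auto)
qed

text \<open>If \<open>exp v\<close> is within \<open>1 / 2\<close> of \<open>1\<close>, then
  \<open>v\<close> differs from the principal logarithm of \<open>exp v\<close> by a multiple of the
  period, and that logarithm has modulus at most \<open>2 * cmod (exp v - 1)\<close>.\<close>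

lemma norm_exp_minus_1_lower_bound:
  fixes v :: complex
  assumes "\<And>k :: int. \<delta> < cmod (v - 2 * of_real pi * of_int k * \<i>)"
  shows "min 1 \<delta> / 2 \<le> cmod (exp v - 1)"
proof (rule ccontr)
  assume *: "\<not> min 1 \<delta> / 2 \<le> cmod (exp v - 1)"
  then have less: "cmod (exp v - 1) < 1 / 2" by auto
  have "exp (Ln (1 + (exp v - 1))) = exp v" by simp
  then obtain k :: int where "v = Ln (1 + (exp v - 1)) + of_int (2 * k) * pi * \<i>"
    unfolding exp_eq by (metis exp_eq exp_Ln exp_not_eq_zero add.commute diff_add_cancel)
  then have "v - 2 * of_real pi * of_int k * \<i> = Ln (1 + (exp v - 1))"
    by (simp add: algebra_simps)
  then have "\<delta> < 2 * cmod (exp v - 1)"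
    using assms[of k] norm_Ln_le[OF less] by simp
  then show False using * by auto
qed

lemma q_power_add: "q_power q (x + y) = q_power q x * q_power q y"
  by (simp add: q_power_def distrib_right exp_add)

lemma q_power_nonzero: "q_power q x \<noteq> 0"
  by (simp add: q_power_def)

text \<open>The shift identity gives \<open>u y - u y' = (q_power q (y - y') - 1) * u y'\<close>.
  Two values close to \<open>1\<close> would thus force the power of \<open>q\<close> at the
  difference close to \<open>1\<close>, against \<open>diff\<close>.\<close>

lemma (in discrete_semigroup) separation_from_difference:
  fixes u :: "complex \<Rightarrow> complex"
  assumes low: "\<And>y. y \<in> G \<Longrightarrow> c1 * Re y powr - \<nu> \<le> cmod (u y - 1)"
    and diff: "\<And>y. y \<in> G \<Longrightarrow> c1 * Re y powr - \<nu> \<le> cmod (q_power q y - 1)"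
    and small: "\<And>y. y \<in> G \<Longrightarrow> c1 * Re y powr - \<nu> \<le> 1 / 2"
    and shift: "\<And>y y'. u y = q_power q (y - y') * u y'"
    and c1: "0 < c1" and \<nu>: "0 < \<nu>"
  shows "\<exists>W K H. 0 < K \<and> 0 < H \<and> siegel_weight (\<lambda>y. min 1 (cmod (u y - 1))) W K H"
proof (rule siegel_weight_exists[of "c1 / 4" \<nu>])
  fix y assume y: "y \<in> G"
  have "0 \<le> c1 * Re y powr - \<nu>" using c1 by simp
  then show "c1 / 4 * Re y powr - \<nu> \<le> min 1 (cmod (u y - 1))" using low[OF y] small[OF y] by auto
next
  fix y y' assume y: "y \<in> G" "y' \<in> G" "y - y' \<in> G"
  define t where "t = c1 * Re (y - y') powr - \<nu>"
  have t: "t \<le> 1 / 2" "t \<le> cmod (q_power q (y - y') - 1)"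
    unfolding t_def using small[OF y(3)] diff[OF y(3)] by auto
  have "t / 4 \<le> max (min 1 (cmod (u y - 1))) (min 1 (cmod (u y' - 1)))"
  proof (rule ccontr)
    assume "\<not> ?thesis"
    then have *: "cmod (u y - 1) < t / 4" "cmod (u y' - 1) < t / 4" using t(1) by auto
    have "1 - cmod (u y') \<le> cmod (u y' - 1)"
      using norm_triangle_ineq2[of 1 "u y'"] by (simp add: norm_minus_commute)
    \<comment> \<open>This factor \<open>1 / 2\<close>, together with the two errors below
      \<open>t / 4\<close>, explains the constant \<open>c1 / 4\<close>.\<close>
    then have half: "1 / 2 \<le> cmod (u y')" using * t(1) by linarith
    have "t * (1 / 2) \<le> cmod (q_power q (y - y') - 1) * cmod (u y')"
      using t(2) half by (intro mult_mono) auto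
    also have "\<dots> = cmod (u y - u y')"
      by (simp add: norm_mult[symmetric] left_diff_distrib shift[of y y', symmetric])
    also have "\<dots> \<le> cmod (u y - 1) + cmod (u y' - 1)"
      using norm_triangle_ineq4[of "u y - 1" "u y' - 1"] by simp
    finally show False using * by linarith
  qed
  then show "c1 / 4 * Re (y - y') powr - \<nu> \<le> max (min 1 (cmod (u y - 1))) (min 1 (cmod (u y' - 1)))"
    by (simp add: t_def)
qed (use c1 \<nu> in auto)

text \<open>Coefficient comparison in \<open>M_eq\<close> is brought into the form required by
  \<open>majorant\<close>, with one index for each monomial of \<open>M\<close> and the product of
  the divisors over the roots of \<open>L\<close> as \<open>\<epsilon>\<close>.\<close>

lemma coefficient_bound:
  fixes q l0 :: complex and L :: "complex poly" and \<psi> :: gps and M :: gen_mpoly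
    and s :: nat and \<alpha>s :: "nat \<Rightarrow> complex"
  defines "G \<equiv> exponent_semigroup s \<alpha>s"
  assumes alphas: "\<And>i. i < s \<Longrightarrow> 0 < Re (\<alpha>s i)"
    and supp: "\<And>y. gps_coeff \<psi> y \<noteq> 0 \<Longrightarrow> y \<in> G"
    and M_form: "\<And>\<beta> p. (\<beta>, p) \<in> Poly_Mapping.keys M \<Longrightarrow> \<beta> \<in> G \<and> Poly_Mapping.keys p \<subseteq> {..degree L}"
    and M_eq: "poly_dilation L (q_power q l0) q \<psi> = gen_qdiff_eval q M \<psi>"
    and L_0: "poly L 0 \<noteq> 0"
    and constants: "0 < C" "0 < \<nu>"
    and lg: "\<And>a. poly ([:- q_power q l0, 1:] * L) a = 0 \<Longrightarrow> exp (lg a) = a"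
    and diophantine: "\<And>a m k. poly ([:- q_power q l0, 1:] * L) a = 0 \<Longrightarrow>
                        m \<in> nz_multi_indices s \<Longrightarrow>
                        cmod ((l0 + multi_comb s \<alpha>s m) * Ln2pi q - lg a
                              - 2 * of_real pi * of_int k * \<i>)
                          > C * real (\<Sum>i<s. m i) powr (- \<nu>)"
  shows "\<exists>x>0. \<forall>S. finite S \<and> S \<subseteq> G \<longrightarrow> (\<Sum>y\<in>S. cmod (gps_coeff \<psi> y) * x powr Re y) \<le> 1"
proof -
  obtain b where "discrete_semigroup G b" and
    b: "\<And>m. m \<in> nz_multi_indices s \<Longrightarrow> 1 \<le> (\<Sum>i<s. m i) \<and> b * real (\<Sum>i<s. m i) \<le> Re (multi_comb s \<alpha>s m)"
    using exponent_semigroup_discrete[of s \<alpha>s] alphas unfolding G_def by metis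
  then interpret discrete_semigroup G b by simp
  \<comment> \<open>\<open>b powr \<nu>\<close> converts the length of \<open>m\<close> into
    \<open>Re y\<close>; the minimum with \<open>1\<close> and the factor \<open>1 / 2\<close> come
    from \<open>norm_exp_minus_1_lower_bound\<close>.\<close>
  define c1 where "c1 = min 1 C * b powr \<nu> / 2"
  have c1: "0 < c1" using constants b_pos by (simp add: c1_def)
  have powr_le: "b powr \<nu> * Re y powr - \<nu> \<le> 1" if "y \<in> G" for y
    using powr_mono2'[OF _ b_pos Re_ge[OF that], of "- \<nu>"] constants b_pos
    by (simp add: powr_minus field_simps)
  have small: "c1 * Re y powr - \<nu> \<le> 1 / 2" if "y \<in> G" for y
  proof -
    have "min 1 C * (b powr \<nu> * Re y powr - \<nu>) \<le> 1 * 1"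
      using powr_le[OF that] constants by (intro mult_mono) auto
    then show ?thesis by (simp add: c1_def)
  qed
  have div_low: "c1 * Re y powr - \<nu> \<le> cmod (q_power q (l0 + y) / a - 1)"
    if y: "y \<in> G" and a: "poly ([:- q_power q l0, 1:] * L) a = 0" for y a
  proof -
    obtain m where m: "m \<in> nz_multi_indices s" "y = multi_comb s \<alpha>s m"
      using y by (auto simp: G_def exponent_semigroup_def)
    define N where "N = real (\<Sum>i<s. m i)"
    have N: "1 \<le> N" "b * N \<le> Re y" using b[OF m(1)] by (auto simp: N_def m(2) simp del: of_nat_sum)
    have "Re y powr - \<nu> \<le> (b * N) powr - \<nu>"
      using N b_pos constants by (intro powr_mono2') auto
    also have "\<dots> = b powr - \<nu> * N powr - \<nu>" using N b_pos by (simp add: powr_mult)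
    finally have "b powr \<nu> * Re y powr - \<nu> \<le> b powr \<nu> * (b powr - \<nu> * N powr - \<nu>)"
      by (intro mult_left_mono) auto
    also have "\<dots> = N powr - \<nu>" using b_pos by (simp add: powr_add[symmetric] mult.assoc[symmetric])
    finally have 1: "b powr \<nu> * Re y powr - \<nu> \<le> N powr - \<nu>" .
    have "min 1 (C * N powr - \<nu>) / 2 \<le> cmod (exp ((l0 + y) * Ln2pi q - lg a) - 1)"
      using diophantine[OF a m(1)] unfolding N_def m(2) by (rule norm_exp_minus_1_lower_bound)
    also have "exp ((l0 + y) * Ln2pi q - lg a) = q_power q (l0 + y) / a"
      by (simp add: exp_diff lg[OF a] q_power_def)
    finally have 2: "min 1 (C * N powr - \<nu>) / 2 \<le> cmod (q_power q (l0 + y) / a - 1)" .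
    have "min 1 C * (b powr \<nu> * Re y powr - \<nu>) \<le> 1 * 1"
      using powr_le[OF y] constants by (intro mult_mono) auto
    moreover have "min 1 C * (b powr \<nu> * Re y powr - \<nu>) \<le> C * N powr - \<nu>"
      using 1 constants by (intro mult_mono) auto
    ultimately show ?thesis using 2 by (simp add: c1_def)
  qed
  obtain A \<kappa> where A: "0 < \<kappa>" "\<And>a. a \<in># A \<Longrightarrow> poly L a = 0"
    "\<And>\<xi>. \<kappa> * max 1 (cmod \<xi>) ^ degree L * (\<Prod>a\<in>#A. min 1 (cmod (\<xi> / a - 1))) \<le> cmod (poly L \<xi>)"
    using poly_lower_bound[OF L_0] by metis
  define \<epsilon> where "\<epsilon> y = (\<Prod>a\<in>#A. min 1 (cmod (q_power q (l0 + y) / a - 1)))" for y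
  have \<epsilon>_pos: "0 < \<epsilon> y" if "y \<in> G" for y
  proof -
    have "0 < min 1 (cmod (q_power q (l0 + y) / a - 1))" if "a \<in># A" for a
    proof -
      have "0 < c1 * Re y powr - \<nu>" using c1 Re_pos[OF \<open>y \<in> G\<close>] by simp
      also have "\<dots> \<le> cmod (q_power q (l0 + y) / a - 1)"
        using A(2)[OF that] \<open>y \<in> G\<close> by (intro div_low) auto
      finally show ?thesis by simp
    qed
    then show ?thesis unfolding \<epsilon>_def by (induction A) auto
  qed
  have "\<exists>W K H. 0 < K \<and> 0 < H \<and> siegel_weight \<epsilon> W K H"
    unfolding \<epsilon>_def
  proof (rule siegel_weight_prod)
    fix a assume a: "a \<in># A"
    show "\<exists>W K H. 0 < K \<and> 0 < H \<and> siegel_weight (\<lambda>y. min 1 (cmod (q_power q (l0 + y) / a - 1))) W K H"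
    proof (rule separation_from_difference[OF _ _ small _ c1 constants(2)])
      fix y y' show "q_power q (l0 + y) / a = q_power q (y - y') * (q_power q (l0 + y') / a)"
        by (simp add: q_power_add[symmetric] add.commute)
    next
      fix y assume y: "y \<in> G"
      show "c1 * Re y powr - \<nu> \<le> cmod (q_power q (l0 + y) / a - 1)"
        using y A(2)[OF a] by (intro div_low) auto
      \<comment> \<open>This is where the root \<open>q_power q l0\<close> of the enlarged
        polynomial is used: its divisor at \<open>y\<close> is
        \<open>q_power q y - 1\<close>.\<close>
      show "c1 * Re y powr - \<nu> \<le> cmod (q_power q y - 1)"
        using div_low[OF y, of "q_power q l0"] by (simp add: q_power_add q_power_nonzero)
    qed auto
  qed auto
  then obtain W K H where W: "siegel_weight \<epsilon> W K H" "0 < K" "0 < H" by blast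
  \<comment> \<open>The factor makes \<open>D\<close> dominate the coefficients of all dilations of
    \<open>\<psi>\<close> up to order \<open>degree L\<close> at once, and the lower bound for
    \<open>L\<close> returns the same power on the left-hand side.\<close>
  define D where "D y = max 1 (cmod (q_power q y)) ^ degree L * cmod (gps_coeff \<psi> y)" for y
  have D_ge: "cmod (gps_coeff \<psi> y) \<le> D y" for y
    unfolding D_def using mult_right_mono[of 1 "max 1 (cmod (q_power q y)) ^ degree L" "cmod (gps_coeff \<psi> y)"]
    by simp
  have D_nonneg: "0 \<le> D y" for y using D_ge[of y] norm_ge_zero order_trans by blast
  have "\<exists>ks. \<forall>p. set (ks p) \<subseteq> Poly_Mapping.keys p \<and> (\<forall>x. power_product x p = prod_list (map x (ks p)))"
    by (rule choice) (metis power_product_eq_prod_list)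
  then obtain ks where ks: "\<And>p. set (ks p) \<subseteq> Poly_Mapping.keys p"
    "\<And>p x. power_product x p = prod_list (map x (ks p))" by metis
  \<comment> \<open>The second factor is the price for replacing \<open>q_power q (l0 + y)\<close>
    by \<open>q_power q y\<close> inside the maximum.\<close>
  define \<kappa>' where "\<kappa>' = \<kappa> * min 1 (cmod (q_power q l0)) ^ degree L"
  have \<kappa>': "0 < \<kappa>'" using A(1) by (simp add: \<kappa>'_def q_power_nonzero)
  have "\<exists>x>0. \<forall>S. finite S \<and> S \<subseteq> G \<longrightarrow> (\<Sum>y\<in>S. D y * x powr Re y) \<le> 1"
  proof (rule majorant[where I = "Poly_Mapping.keys M" and \<beta> = fst and len = "\<lambda>i. length (ks (snd i))"
      and m = "\<lambda>i. cmod (Poly_Mapping.lookup M i) / \<kappa>'" and D = D and \<epsilon> = \<epsilon>, OF _ _ _ _ _ _ W])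
    fix y R assume y: "y \<in> G" "Re y \<le> R + b"
    have "\<kappa>' * (\<epsilon> y * D y) \<le> (\<kappa> * max 1 (cmod (q_power q (l0 + y))) ^ degree L * \<epsilon> y) * cmod (gps_coeff \<psi> y)"
    proof -
      have "min 1 (cmod (q_power q l0)) * max 1 (cmod (q_power q y)) \<le> max 1 (cmod (q_power q (l0 + y)))"
      proof (cases "1 \<le> cmod (q_power q y)")
        case True
        have "min 1 (cmod (q_power q l0)) * cmod (q_power q y) \<le> cmod (q_power q l0) * cmod (q_power q y)"
          by (intro mult_right_mono) auto
        then show ?thesis using True by (simp add: q_power_add norm_mult)
      qed (auto simp: max_def)
      then have "(min 1 (cmod (q_power q l0)) * max 1 (cmod (q_power q y))) ^ degree L \<le>
          max 1 (cmod (q_power q (l0 + y))) ^ degree L"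
        by (intro power_mono) auto
      then have "(min 1 (cmod (q_power q l0)) * max 1 (cmod (q_power q y))) ^ degree L * (\<kappa> * \<epsilon> y * cmod (gps_coeff \<psi> y)) \<le>
          max 1 (cmod (q_power q (l0 + y))) ^ degree L * (\<kappa> * \<epsilon> y * cmod (gps_coeff \<psi> y))"
        using A(1) \<epsilon>_pos[OF y(1)] by (intro mult_right_mono) auto
      then show ?thesis by (simp add: \<kappa>'_def D_def power_mult_distrib mult_ac)
    qed
    also have "\<dots> \<le> cmod (poly L (q_power q (l0 + y))) * cmod (gps_coeff \<psi> y)"
      unfolding \<epsilon>_def by (intro mult_right_mono A(3)) auto
    also have "\<dots> = cmod (gps_coeff (gen_qdiff_eval q M \<psi>) y)"
      by (simp add: M_eq[symmetric] gps_coeff_poly_dilation norm_mult q_power_add)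
    also have "\<dots> \<le> (\<Sum>i\<in>Poly_Mapping.keys M. cmod (Poly_Mapping.lookup M i) *
        (\<Sum>ys | set ys \<subseteq> below R \<and> length ys = length (ks (snd i)) \<and> fst i + sum_list ys = y. prod_list (map D ys)))"
      unfolding gen_qdiff_eval_def gps_coeff_sum case_prod_beta
    proof (rule sum_norm_le)
      fix i assume "i \<in> Poly_Mapping.keys M"
      then have i: "fst i \<in> G" "Poly_Mapping.keys (snd i) \<subseteq> {..degree L}"
        using M_form[of "fst i" "snd i"] by auto
      have "cmod (gps_coeff (prod_list (map (\<lambda>k. (dilation q ^^ k) \<psi>) (ks (snd i)))) (y - fst i)) \<le>
          (\<Sum>ys | set ys \<subseteq> below R \<and> length ys = length (map (\<lambda>k. (dilation q ^^ k) \<psi>) (ks (snd i))) \<and>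
            sum_list ys = y - fst i. prod_list (map D ys))"
      proof (rule norm_coeff_prod_list)
        fix f assume "f \<in> set (map (\<lambda>k. (dilation q ^^ k) \<psi>) (ks (snd i)))"
        then obtain k where k: "k \<le> degree L" "f = (dilation q ^^ k) \<psi>"
          using ks(1)[of "snd i"] i(2) by auto
        show "supported f" using supp by (auto simp: supported_def k gps_coeff_dilation_power)
        fix x
        have "cmod (q_power q x) ^ k \<le> max 1 (cmod (q_power q x)) ^ k" by (intro power_mono) auto
        also have "\<dots> \<le> max 1 (cmod (q_power q x)) ^ degree L" using k by (intro power_increasing) auto
        finally show "cmod (gps_coeff f x) \<le> D x"
          by (simp add: k gps_coeff_dilation_power norm_mult norm_power D_def mult_right_mono)
      next
        \<comment> \<open>The factor with exponent \<open>fst i\<close> uses up at least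
          \<open>b\<close> of the real part, so only earlier coefficients occur.\<close>
        show "Re (y - fst i) \<le> R" using y(2) Re_ge[OF i(1)] by simp
      qed
      then show "cmod (gps_coeff (gps_monom (Poly_Mapping.lookup M (fst i, snd i)) (fst i) *
          power_product (\<lambda>k. (dilation q ^^ k) \<psi>) (snd i)) y) \<le>
          cmod (Poly_Mapping.lookup M i) * (\<Sum>ys | set ys \<subseteq> below R \<and> length ys = length (ks (snd i)) \<and>
            fst i + sum_list ys = y. prod_list (map D ys))"
        by (auto simp: gps_coeff_monom_mult ks(2) norm_mult eq_diff_eq add.commute intro!: mult_left_mono)
    qed
    finally have "\<epsilon> y * D y \<le> 1 / \<kappa>' * (\<Sum>i\<in>Poly_Mapping.keys M. cmod (Poly_Mapping.lookup M i) *
        (\<Sum>ys | set ys \<subseteq> below R \<and> length ys = length (ks (snd i)) \<and> fst i + sum_list ys = y. prod_list (map D ys)))"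
      using \<kappa>' by (simp add: field_simps)
    then show "\<epsilon> y * D y \<le> (\<Sum>i\<in>Poly_Mapping.keys M. cmod (Poly_Mapping.lookup M i) / \<kappa>' *
        (\<Sum>ys | set ys \<subseteq> below R \<and> length ys = length (ks (snd i)) \<and> fst i + sum_list ys = y. prod_list (map D ys)))"
      by (simp add: sum_divide_distrib)
  qed (use M_form D_nonneg \<epsilon>_pos \<kappa>' in auto)
  then obtain x where x: "0 < x" "\<And>S. finite S \<Longrightarrow> S \<subseteq> G \<Longrightarrow> (\<Sum>y\<in>S. D y * x powr Re y) \<le> 1" by blast
  show ?thesis
  proof (intro exI[of _ x] conjI allI impI)
    fix S assume S: "finite S \<and> S \<subseteq> G"
    have "(\<Sum>y\<in>S. cmod (gps_coeff \<psi> y) * x powr Re y) \<le> (\<Sum>y\<in>S. D y * x powr Re y)"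
      by (intro sum_mono mult_right_mono D_ge) auto
    also have "\<dots> \<le> 1" using x(2) S by auto
    finally show "(\<Sum>y\<in>S. cmod (gps_coeff \<psi> y) * x powr Re y) \<le> 1" .
  qed (rule x(1))
qed

section \<open>Convergence in sectors\<close>

lemma inf_sector_eq_exp_strip: "inf_sector \<theta>1 \<theta>2 = exp ` {w. \<theta>1 < Im w \<and> Im w < \<theta>2}"
proof (intro equalityI subsetI)
  fix z assume "z \<in> inf_sector \<theta>1 \<theta>2"
  then obtain \<rho> t where "z = rcis \<rho> t" "0 < \<rho>" "\<theta>1 < t" "t < \<theta>2" by (auto simp: inf_sector_def)
  then show "z \<in> exp ` {w. \<theta>1 < Im w \<and> Im w < \<theta>2}"
    by (intro image_eqI[of _ _ "Complex (ln \<rho>) t"]) (auto simp: exp_eq_polar rcis_def)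
next
  fix z assume "z \<in> exp ` {w. \<theta>1 < Im w \<and> Im w < \<theta>2}"
  then obtain w where "z = exp w" "\<theta>1 < Im w" "Im w < \<theta>2" by auto
  moreover from this have "z = rcis (exp (Re w)) (Im w)" by (simp add: exp_eq_polar rcis_def)
  ultimately show "z \<in> inf_sector \<theta>1 \<theta>2"
    unfolding inf_sector_def using exp_gt_zero by blast
qed

text \<open>An opening below \<open>2 * pi\<close> makes \<open>exp\<close> injective on the strip,
  so the image of the strip is open.\<close>

lemma open_sector:
  assumes "\<theta>2 - \<theta>1 < 2 * pi"
  shows "open (sector \<theta>1 \<theta>2 r)"
proof -
  have "open {w. \<theta>1 < Im w \<and> Im w < \<theta>2}"
    by (intro open_Collect_conj open_Collect_less continuous_intros)
  moreover have "inj_on exp {w. \<theta>1 < Im w \<and> Im w < \<theta>2}"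
    using assms by (auto intro!: inj_onI exp_complex_eqI)
  ultimately have "open (exp ` {w. \<theta>1 < Im w \<and> Im w < \<theta>2} :: complex set)"
    by (intro open_mapping_thm3 holomorphic_intros)
  then show ?thesis unfolding sector_def inf_sector_eq_exp_strip by auto
qed

text \<open>On the strip, \<open>lg (exp w) - w\<close> is continuous and its distinct values are at
  least \<open>2 * pi\<close> apart, so it is constant. Any branch therefore has bounded imaginary
  part, as needed for complex exponents.\<close>

lemma log_branch_Im_bounded:
  assumes "log_branch_on (inf_sector \<theta>1 \<theta>2) lg"
  obtains \<Theta> where "0 \<le> \<Theta>" "\<And>z. z \<in> inf_sector \<theta>1 \<theta>2 \<Longrightarrow> \<bar>Im (lg z)\<bar> \<le> \<Theta>"
proof -
  let ?S = "{w. \<theta>1 < Im w \<and> Im w < \<theta>2}"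
  define h where "h w = lg (exp w) - w" for w
  have exp_lg: "exp (lg (exp w)) = exp w" if "w \<in> ?S" for w
    using assms that by (auto simp: log_branch_on_def inf_sector_eq_exp_strip)
  have "?S = {w. \<theta>1 < Im w} \<inter> {w. Im w < \<theta>2}" by auto
  then have "convex ?S" by (simp only: convex_Int convex_halfspace_Im_gt convex_halfspace_Im_lt)
  then have conn: "connected ?S" by (rule convex_connected)
  have "continuous_on (exp ` ?S) lg"
    using assms by (simp add: log_branch_on_def inf_sector_eq_exp_strip)
  then have "continuous_on ?S (\<lambda>w. lg (exp w))"
    by (rule continuous_on_compose2) (auto intro: continuous_intros)
  then have cont: "continuous_on ?S h"
    unfolding h_def by (intro continuous_on_diff continuous_on_id)
  have "h constant_on ?S"
  proof (rule continuous_discrete_range_constant[OF conn cont])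
    fix x assume x: "x \<in> ?S"
    have "2 * pi \<le> norm (h y - h x)" if "y \<in> ?S" "h y \<noteq> h x" for y
    proof -
      have "exp (h y - h x) = 1"
        using exp_lg[OF that(1)] exp_lg[OF x] by (simp add: h_def exp_diff)
      then obtain n :: int where n: "Re (h y - h x) = 0" "Im (h y - h x) = of_int (2 * n) * pi"
        unfolding exp_eq_1 by blast
      have "n \<noteq> 0"
      proof
        assume "n = 0"
        then show False using n that(2) by (simp add: complex_eq_iff)
      qed
      then have "1 \<le> \<bar>real_of_int n\<bar>" by linarith
      then have "2 * pi * 1 \<le> 2 * pi * \<bar>real_of_int n\<bar>" by (intro mult_left_mono) auto
      also have "\<dots> = \<bar>Im (h y - h x)\<bar>" unfolding n by (simp add: abs_mult)
      also have "\<dots> \<le> norm (h y - h x)" by (rule abs_Im_le_cmod)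
      finally show ?thesis by simp
    qed
    then show "\<exists>e>0. \<forall>y. y \<in> ?S \<and> h y \<noteq> h x \<longrightarrow> e \<le> norm (h y - h x)"
      by (intro exI[of _ "2 * pi"]) auto
  qed
  then obtain k where k: "\<And>w. w \<in> ?S \<Longrightarrow> h w = k" by (auto simp: constant_on_def)
  show thesis
  proof
    show "0 \<le> max \<bar>\<theta>1\<bar> \<bar>\<theta>2\<bar> + \<bar>Im k\<bar>" by simp
    fix z assume "z \<in> inf_sector \<theta>1 \<theta>2"
    then obtain w where w: "z = exp w" "w \<in> ?S" by (auto simp: inf_sector_eq_exp_strip)
    then have "lg z = w + k" using k[OF w(2)] by (simp add: h_def algebra_simps)
    then show "\<bar>Im (lg z)\<bar> \<le> max \<bar>\<theta>1\<bar> \<bar>\<theta>2\<bar> + \<bar>Im k\<bar>" using w(2) by auto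
  qed
qed

lemma log_branch_holomorphic:
  assumes "open S" "log_branch_on S lg"
  shows "lg holomorphic_on S"
proof (rule holomorphic_onI)
  fix z assume z: "z \<in> S"
  have "(lg has_field_derivative inverse z) (at z)"
  proof (rule has_field_derivative_inverse_basic[OF _ _ _ assms(1) z])
    show "(exp has_field_derivative z) (at (lg z))"
      using assms(2) z DERIV_exp[of "lg z"] by (simp add: log_branch_on_def)
    show "z \<noteq> 0" using assms(2) z exp_not_eq_zero[of "lg z"] by (auto simp: log_branch_on_def)
    show "continuous (at z) lg"
      using assms z by (simp add: log_branch_on_def continuous_on_eq_continuous_at)
  qed (use assms(2) in \<open>auto simp: log_branch_on_def\<close>)
  then show "lg field_differentiable at z within S"
    unfolding field_differentiable_def using has_field_derivative_at_within by blast
qed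

text \<open>Weierstrass M-test: the modulus of a power is
  \<open>exp (Re (\<mu> j) * Re (lg z) - Im (\<mu> j) * Im (lg z))\<close>. The cone condition
  bounds the second term by a multiple of \<open>Re (\<mu> j - l0)\<close> plus a constant, and a
  small radius makes the first term outweigh it.\<close>

lemma converges_in_small_sectorsI:
  fixes c \<mu> :: "nat \<Rightarrow> complex" and l0 :: complex
  assumes lim: "filterlim (\<lambda>j. Re (\<mu> j)) at_top sequentially"
    and x: "0 < x" and \<kappa>: "0 \<le> \<kappa>"
    and cone: "\<And>j. j0 < j \<Longrightarrow> \<bar>Im (\<mu> j - l0)\<bar> \<le> \<kappa> * Re (\<mu> j - l0)"
    and bound: "\<And>N. (\<Sum>j\<in>{j0<..<N}. cmod (c j) * x powr Re (\<mu> j - l0)) \<le> 1"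
  shows "converges_in_small_sectors c \<mu>"
  unfolding converges_in_small_sectors_def
proof (intro allI impI, elim conjE)
  fix \<theta>1 \<theta>2 lg
  assume \<theta>: "\<theta>2 - \<theta>1 < 2 * pi" and lg: "log_branch_on (inf_sector \<theta>1 \<theta>2) lg"
  obtain \<Theta> where \<Theta>: "0 \<le> \<Theta>" "\<And>z. z \<in> inf_sector \<theta>1 \<theta>2 \<Longrightarrow> \<bar>Im (lg z)\<bar> \<le> \<Theta>"
    using log_branch_Im_bounded[OF lg] by blast
  \<comment> \<open>The logarithm of the radius. It must beat \<open>ln x\<close> and the
    contribution \<open>\<kappa> * \<Theta>\<close> of the imaginary parts; the factor
    \<open>2\<close> is needed because only half of \<open>Re (\<mu> j - l0)\<close> is guaranteed
    as a lower bound for \<open>Re (\<mu> j)\<close>.\<close>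
  define \<rho> where "\<rho> = min 0 (2 * (ln x - \<kappa> * \<Theta>))"
  define S where "S = sector \<theta>1 \<theta>2 (exp \<rho>)"
  have S_sub: "S \<subseteq> inf_sector \<theta>1 \<theta>2" by (auto simp: S_def sector_def)
  have open_S: "open S" unfolding S_def using \<theta> by (rule open_sector)
  have lg_S: "log_branch_on S lg"
    using lg S_sub by (auto simp: log_branch_on_def intro: continuous_on_subset)
  have Re_lg: "Re (lg z) \<le> \<rho>" if "z \<in> S" for z
  proof -
    have "exp (Re (lg z)) = cmod z" using lg_S that norm_exp_eq_Re[of "lg z"] by (simp add: log_branch_on_def)
    also have "\<dots> < exp \<rho>" using that by (simp add: S_def sector_def)
    finally show ?thesis by simp
  qed
  define B where "B j = (if j0 < j then exp (\<bar>Im l0\<bar> * \<Theta>) * (cmod (c j) * x powr Re (\<mu> j - l0)) else 0)" for j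
  have "summable B"
  proof (rule summableI_nonneg_bounded)
    show "0 \<le> B j" for j by (simp add: B_def)
    fix N
    have "(\<Sum>j<N. B j) = exp (\<bar>Im l0\<bar> * \<Theta>) * (\<Sum>j\<in>{j0<..<N}. cmod (c j) * x powr Re (\<mu> j - l0))"
      unfolding sum_distrib_left by (rule sum.mono_neutral_cong_right) (auto simp: B_def)
    also have "\<dots> \<le> exp (\<bar>Im l0\<bar> * \<Theta>) * 1" by (intro mult_left_mono bound) auto
    finally show "(\<Sum>j<N. B j) \<le> exp (\<bar>Im l0\<bar> * \<Theta>) * 1" .
  qed
  moreover have "eventually (\<lambda>j. \<forall>z\<in>S. norm (c j * exp (\<mu> j * lg z)) \<le> B j) sequentially"
  proof -
    \<comment> \<open>For such \<open>j\<close> the real part of \<open>\<mu> j - l0\<close> is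
      non-negative and at most \<open>2 * Re (\<mu> j)\<close>. Finitely many earlier terms do not
      matter for the M-test.\<close>
    have "eventually (\<lambda>j. \<bar>Re l0\<bar> \<le> Re (\<mu> j)) sequentially"
      using lim unfolding filterlim_at_top by blast
    then show ?thesis using eventually_gt_at_top[of j0]
    proof eventually_elim
      case (elim j)
      show ?case
      proof
        fix z assume z: "z \<in> S"
        define g where "g = Re (\<mu> j - l0)"
        have g: "g \<le> 2 * Re (\<mu> j)" "0 \<le> Re (\<mu> j)" using elim by (auto simp: g_def)
        have g_nonneg: "0 \<le> g"
          using cone[OF elim(2)] \<kappa> elim(1) by (auto simp: g_def)
        have "Re (\<mu> j) * Re (lg z) \<le> Re (\<mu> j) * \<rho>" using Re_lg[OF z] g by (intro mult_left_mono)
        also have "\<dots> \<le> g / 2 * \<rho>" using g by (intro mult_right_mono_neg) (auto simp: \<rho>_def)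
        also have "\<dots> \<le> g / 2 * (2 * (ln x - \<kappa> * \<Theta>))" using g_nonneg by (intro mult_left_mono) (auto simp: \<rho>_def)
        finally have 1: "Re (\<mu> j) * Re (lg z) \<le> g * ln x - \<kappa> * g * \<Theta>" by (simp add: algebra_simps)
        have "- (Im (\<mu> j) * Im (lg z)) \<le> \<bar>Im (\<mu> j)\<bar> * \<bar>Im (lg z)\<bar>"
          by (metis abs_ge_minus_self abs_mult)
        also have "\<dots> \<le> (\<bar>Im l0\<bar> + \<kappa> * g) * \<Theta>"
          using cone[OF elim(2)] \<Theta>(2)[of z] z S_sub \<kappa> g_nonneg by (intro mult_mono) (auto simp: g_def)
        finally have 2: "- (Im (\<mu> j) * Im (lg z)) \<le> \<bar>Im l0\<bar> * \<Theta> + \<kappa> * g * \<Theta>" by (simp add: algebra_simps)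
        have "norm (exp (\<mu> j * lg z)) = exp (Re (\<mu> j) * Re (lg z) - Im (\<mu> j) * Im (lg z))"
          by (simp add: norm_exp_eq_Re)
        also have "\<dots> \<le> exp (\<bar>Im l0\<bar> * \<Theta> + g * ln x)" using 1 2 by simp
        also have "\<dots> = exp (\<bar>Im l0\<bar> * \<Theta>) * x powr g" using x by (simp add: exp_add powr_def)
        finally have "norm (c j) * norm (exp (\<mu> j * lg z)) \<le> norm (c j) * (exp (\<bar>Im l0\<bar> * \<Theta>) * x powr g)"
          by (intro mult_left_mono) auto
        then show "norm (c j * exp (\<mu> j * lg z)) \<le> B j"
          using elim(2) by (simp add: B_def norm_mult g_def mult_ac)
      qed
    qed
  qed
  ultimately have unif: "uniform_limit S (\<lambda>N z. \<Sum>j<N. c j * exp (\<mu> j * lg z))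
      (\<lambda>z. suminf (\<lambda>j. c j * exp (\<mu> j * lg z))) sequentially"
    by (intro Weierstrass_m_test_ev)
  have "(\<lambda>z. suminf (\<lambda>j. c j * exp (\<mu> j * lg z))) holomorphic_on S"
  proof (rule holomorphic_uniform_sequence[OF open_S])
    show "(\<lambda>z. \<Sum>j<N. c j * exp (\<mu> j * lg z)) holomorphic_on S" for N
      by (intro holomorphic_intros log_branch_holomorphic open_S lg_S)
    fix z assume "z \<in> S"
    then obtain d where "0 < d" "cball z d \<subseteq> S" using open_S open_contains_cball by blast
    then show "\<exists>d>0. cball z d \<subseteq> S \<and> uniform_limit (cball z d) (\<lambda>N z. \<Sum>j<N. c j * exp (\<mu> j * lg z))
        (\<lambda>z. suminf (\<lambda>j. c j * exp (\<mu> j * lg z))) sequentially"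
      using uniform_limit_on_subset[OF unif] by blast
  qed
  then show "\<exists>r>0. \<exists>f. f holomorphic_on sector \<theta>1 \<theta>2 r \<and>
      uniform_limit (sector \<theta>1 \<theta>2 r) (\<lambda>N z. \<Sum>j<N. c j * exp (\<mu> j * lg z)) f sequentially"
    using unif unfolding S_def by (intro exI[of _ "exp \<rho>"]) auto
qed

section \<open>Assembly: from the coefficients of \<open>\<psi>\<close> back to the given
  series\<close>

theorem theorem1:
  fixes q :: complex and n :: nat and F :: mpoly
    and c \<mu> :: "nat \<Rightarrow> complex" and \<phi> :: gps
    and A :: "nat \<Rightarrow> complex" and \<alpha> :: complex and L :: "complex poly"
    and j\<^sub>0 s :: nat and \<alpha>s :: "nat \<Rightarrow> complex"
    and cm :: "(nat \<Rightarrow> nat) \<Rightarrow> complex" and \<psi> :: gps and M :: gen_mpoly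
    and C \<nu> :: real and lg :: "complex \<Rightarrow> complex"
  assumes q: "q \<noteq> 0" "q \<noteq> 1"
    and F: "mpoly_vars F \<subseteq> {..Suc n}"
    and series: "gen_power_series c \<mu>"
    and phi: "\<phi> = gps_series UNIV c \<mu>"
    and solution: "qdiff_eval q F \<phi> = 0"
    and leading: "\<And>k. k \<le> n \<Longrightarrow> gps_coeff (qdiff_eval q (mpoly_pderiv (Suc k) F) \<phi>) \<alpha> = A k"
    and higher: "\<And>k \<beta>. k \<le> n \<Longrightarrow> gps_coeff (qdiff_eval q (mpoly_pderiv (Suc k) F) \<phi>) \<beta> \<noteq> 0 \<Longrightarrow>
                   \<beta> \<noteq> \<alpha> \<Longrightarrow> Re \<alpha> < Re \<beta>"
    and alpha: "0 \<le> Re \<alpha>"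
    and A_nonzero: "\<exists>k\<le>n. A k \<noteq> 0"
    and L_def: "L = (\<Sum>k\<le>n. monom (A k) k)"
    and nonresonant: "\<And>j. j\<^sub>0 < j \<Longrightarrow> poly L (q_power q (\<mu> j)) \<noteq> 0"
    and alphas: "\<And>i. i < s \<Longrightarrow> 0 < Re (\<alpha>s i)"
    and exponents: "\<And>j. j\<^sub>0 < j \<Longrightarrow> \<mu> j - \<mu> j\<^sub>0 \<in> exponent_semigroup s \<alpha>s"
    and phi_form: "\<phi> = gps_series {..j\<^sub>0} c \<mu> +
                     gps_series (nz_multi_indices s) cm (\<lambda>m. \<mu> j\<^sub>0 + multi_comb s \<alpha>s m)"
    and psi: "\<psi> = gps_series (nz_multi_indices s) cm (multi_comb s \<alpha>s)"
    and M_form: "\<And>\<beta> p. (\<beta>, p) \<in> Poly_Mapping.keys M \<Longrightarrow>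
                   \<beta> \<in> exponent_semigroup s \<alpha>s \<and> Poly_Mapping.keys p \<subseteq> {..n}"
    and M_eq: "poly_dilation L (q_power q (\<mu> j\<^sub>0)) q \<psi> = gen_qdiff_eval q M \<psi>"
    and deg_L: "degree L = n"
    and L_0: "poly L 0 \<noteq> 0"
    and constants: "0 < C" "0 < \<nu>"
    and lg: "\<And>a. poly ([:- q_power q (\<mu> j\<^sub>0), 1:] * L) a = 0 \<Longrightarrow> exp (lg a) = a"
    and diophantine: "\<And>a m k. poly ([:- q_power q (\<mu> j\<^sub>0), 1:] * L) a = 0 \<Longrightarrow>
                        m \<in> nz_multi_indices s \<Longrightarrow>
                        cmod ((\<mu> j\<^sub>0 + multi_comb s \<alpha>s m) * Ln2pi q - lg a
                              - 2 * of_real pi * of_int k * \<i>)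
                          > C * real (\<Sum>i<s. m i) powr (- \<nu>)"
  shows "converges_in_small_sectors c \<mu>"
proof -
  define G where "G = exponent_semigroup s \<alpha>s"
  obtain \<kappa> where \<kappa>: "0 \<le> \<kappa>" "\<And>y. y \<in> G \<Longrightarrow> \<bar>Im y\<bar> \<le> \<kappa> * Re y"
    using exponent_semigroup_discrete[of s \<alpha>s] alphas unfolding G_def by metis
  have coeff_psi: "gps_coeff \<psi> y = (\<Sum>m | m \<in> nz_multi_indices s \<and> multi_comb s \<alpha>s m = y. cm m)" for y
    unfolding psi by (rule gps_coeff_series) (use multi_comb_finite[of s \<alpha>s 0] alphas in simp)
  have supp: "y \<in> G" if "gps_coeff \<psi> y \<noteq> 0" for y
  proof (rule ccontr)
    assume "y \<notin> G"
    then have "{m. m \<in> nz_multi_indices s \<and> multi_comb s \<alpha>s m = y} = {}"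
      by (auto simp: G_def exponent_semigroup_def)
    then show False using that unfolding coeff_psi by (simp only: sum.empty)
  qed
  have "\<exists>x>0. \<forall>S. finite S \<and> S \<subseteq> G \<longrightarrow> (\<Sum>y\<in>S. cmod (gps_coeff \<psi> y) * x powr Re y) \<le> 1"
    unfolding G_def
  proof (rule coefficient_bound[OF alphas _ _ M_eq L_0 constants lg diophantine])
    show "y \<in> exponent_semigroup s \<alpha>s" if "gps_coeff \<psi> y \<noteq> 0" for y
      using supp[OF that] by (simp only: G_def)
    show "\<beta> \<in> exponent_semigroup s \<alpha>s \<and> Poly_Mapping.keys p \<subseteq> {..degree L}"
      if "(\<beta>, p) \<in> Poly_Mapping.keys M" for \<beta> p
      using M_form[OF that] by (simp only: deg_L)
  qed
  then obtain x where x: "0 < x"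
    "\<And>S. finite S \<Longrightarrow> S \<subseteq> G \<Longrightarrow> (\<Sum>y\<in>S. cmod (gps_coeff \<psi> y) * x powr Re y) \<le> 1"
    by blast
  have inj: "inj \<mu>" using series by (simp add: gen_power_series_def)
  \<comment> \<open>The exponents are pairwise distinct, so the coefficient of \<open>\<phi>\<close>
    at \<open>\<mu> j\<close> is \<open>c j\<close> and the initial segment contributes nothing
    there. What remains is the tail, a shift of \<open>\<psi>\<close> with equal powers
    collected.\<close>
  have coeff_c: "c j = gps_coeff \<psi> (\<mu> j - \<mu> j\<^sub>0)" if j: "j\<^sub>0 < j" for j
  proof -
    have "gps_coeff \<phi> (\<mu> j) = (\<Sum>i | i \<in> UNIV \<and> \<mu> i = \<mu> j. c i)"
      unfolding phi by (rule gps_coeff_series) (rule gen_power_series_finite[OF series])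
    also have "{i. i \<in> UNIV \<and> \<mu> i = \<mu> j} = {j}" using inj by (auto dest: injD)
    finally have "gps_coeff \<phi> (\<mu> j) = c j" by simp
    moreover have "gps_coeff (gps_series {..j\<^sub>0} c \<mu>) (\<mu> j) = (\<Sum>i | i \<in> {..j\<^sub>0} \<and> \<mu> i = \<mu> j. c i)"
      by (rule gps_coeff_series) simp
    moreover have "{i. i \<in> {..j\<^sub>0} \<and> \<mu> i = \<mu> j} = {}" using inj j by (auto dest: injD)
    moreover have "gps_coeff (gps_series (nz_multi_indices s) cm (\<lambda>m. \<mu> j\<^sub>0 + multi_comb s \<alpha>s m)) (\<mu> j) =
        (\<Sum>m | m \<in> nz_multi_indices s \<and> \<mu> j\<^sub>0 + multi_comb s \<alpha>s m = \<mu> j. cm m)"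
      by (rule gps_coeff_series) (rule multi_comb_finite[OF alphas])
    moreover have "{m. m \<in> nz_multi_indices s \<and> \<mu> j\<^sub>0 + multi_comb s \<alpha>s m = \<mu> j} =
        {m. m \<in> nz_multi_indices s \<and> multi_comb s \<alpha>s m = \<mu> j - \<mu> j\<^sub>0}"
      by (auto simp: algebra_simps)
    ultimately show ?thesis
      unfolding coeff_psi by (metis (no_types, lifting) add_0 phi_form plus_gps.rep_eq sum.empty)
  qed
  show ?thesis
  proof (rule converges_in_small_sectorsI[OF _ x(1) \<kappa>(1)])
    show "filterlim (\<lambda>j. Re (\<mu> j)) at_top sequentially"
      using series by (simp add: gen_power_series_def)
    show "\<bar>Im (\<mu> j - \<mu> j\<^sub>0)\<bar> \<le> \<kappa> * Re (\<mu> j - \<mu> j\<^sub>0)" if "j\<^sub>0 < j" for j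
      using exponents[OF that] by (intro \<kappa>(2)) (simp add: G_def)
    fix N
    have "(\<Sum>j\<in>{j\<^sub>0<..<N}. cmod (c j) * x powr Re (\<mu> j - \<mu> j\<^sub>0)) =
        (\<Sum>j\<in>{j\<^sub>0<..<N}. cmod (gps_coeff \<psi> (\<mu> j - \<mu> j\<^sub>0)) * x powr Re (\<mu> j - \<mu> j\<^sub>0))"
      by (intro sum.cong) (auto simp: coeff_c)
    \<comment> \<open>By injectivity of \<open>\<mu>\<close> every exponent of \<open>G\<close> is
      used at most once, so the sum runs over a finite subset of \<open>G\<close>.\<close>
    also have "\<dots> = (\<Sum>y\<in>(\<lambda>j. \<mu> j - \<mu> j\<^sub>0) ` {j\<^sub>0<..<N}. cmod (gps_coeff \<psi> y) * x powr Re y)"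
      using inj by (subst sum.reindex) (auto intro!: inj_onI dest: injD)
    also have "\<dots> \<le> 1"
      using exponents by (intro x(2)) (auto simp: G_def)
    finally show "(\<Sum>j\<in>{j\<^sub>0<..<N}. cmod (c j) * x powr Re (\<mu> j - \<mu> j\<^sub>0)) \<le> 1" .
  qed
qed

end
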